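(* Let $d,P\in\mathbb{N}$, $b\in\mathbb{R}^d$, $\sigma=(\sigma_1,\ldots,\sigma_P)\in\mathbb{R}^{d\times P}$ with columns $\sigma_j\in\mathbb{R}^d$, and let $\mu\ge 0$ be a Radon measure on $\mathbb{R}^d\setminus\{0\}$ with $\int_{\mathbb{R}^d\setminus\{0\}}\min\{|z|^2,1\}\,\mathrm{d}\mu(z)<\infty$. Let $\mathcal{L}=\mathcal{L}^{\sigma,b}+\mathcal{L}^{\mu}$ and let $u\in L^\infty(\mathbb{R}^d)$. Then the following statements are equivalent: (a) $\mathcal{L}[u]=0$ in $\mathcal{D}'(\mathbb{R}^d)$. (b) $u$ is a.e. $\overline{G_\mu+W_{\sigma,b+c_\mu}}$-periodic.
   Context: Operators: for smooth bounded $u$ with bounded derivatives, $$\mathcal{L}^{\sigma,b}[u](x)=\mathrm{tr}(\sigma\sigma^{\mathtt T}D^2u(x))+b\cdot Du(x),$$ $$\mathcal{L}^{\mu}[u](x)=\int_{\mathbb{R}^d\setminus\{0\}}\big(u(x+z)-u(x)-z\cdot Du(x)\mathbf{1}_{|z|\le 1}\big)\,\mathrm{d}\mu(z).$$ For $u\in L^\infty(\mathbb{R}^d)$, the distribution $\mathcal{L}[u]\in\mathcal{D}'(\mathbb{R}^d)$ is defined by $\langle\mathcal{L}[u],\psi\rangle=\int_{\mathbb{R}^d}u(x)\,\mathcal{L}^*[\psi](x)\,\mathrm{d}x$ for all $\psi\in C^\infty_{\mathrm c}(\mathbb{R}^d)$, where $\mathcal{L}^*=\mathcal{L}^{\sigma,-b}+\mathcal{L}^{\mu^*}$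 and $\mathrm{d}\mu^*(z)=\mathrm{d}\mu(-z)$ (this is well-defined since $\mathcal{L}^*:W^{2,1}(\mathbb{R}^d)\to L^1(\mathbb{R}^d)$ is bounded). Periodicity: for $S\subseteq\mathbb{R}^d$, $u\in L^\infty(\mathbb{R}^d)$ is a.e. $S$-periodic if $\int_{\mathbb{R}^d}(u(x+s)-u(x))\psi(x)\,\mathrm{d}x=0$ for all $s\in S$ and all $\psi\in C^\infty_{\mathrm c}(\mathbb{R}^d)$. Support and groups: $\mathrm{supp}(\mu)=\{z\in\mathbb{R}^d\setminus\{0\}:\mu(B_r(z))>0\ \forall r>0\}$, where $B_r(z)$ is the ball of center $z$ and radius $r$. For $S\subseteq\mathbb{R}^d$, $G(S)$ is the smallest additive subgroup of $\mathbb{R}^d$ containing $S$. Set $G_\mu=\overline{G(\mathrm{supp}(\mu))}$ and $V_\mu=\{g\in G_\mu: tg\in G_\mu\ \forall t\in\mathbb{R}\}$ (a vector subspace of $\mathbb{R}^d$). Drift correction: $c_\mu=-\int_{\{|z|\le1\}\setminus V_\mu}z\,\mathrm{d}\mu(z)\in\mathbb{R}^d$ (the integral is well-defined). Finally $W_{\sigma,b+c_\mu}=\mathrm{span}_{\mathbb{R}}\{\sigma_1,\ldots,\sigma_P,b+c_\mu\}$. *)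

theory Defs
  imports "HOL-Analysis.Analysis" "HOL-Computational_Algebra.Group_Closure"
begin

section \<open>Test functions\<close>

definition partial :: "'d \<Rightarrow> (real^'d \<Rightarrow> real) \<Rightarrow> real^'d \<Rightarrow> real" where
  "partial i f x = frechet_derivative f (at x) (axis i 1)"

definition grad :: "(real^'d \<Rightarrow> real) \<Rightarrow> real^'d \<Rightarrow> real^'d" where
  "grad f x = (\<chi> i. partial i f x)"

definition hessian :: "(real^'d \<Rightarrow> real) \<Rightarrow> real^'d \<Rightarrow> real^'d^'d" where
  "hessian f x = (\<chi> i j. partial i (partial j f) x)"

primrec C_k :: "nat \<Rightarrow> (real^'d \<Rightarrow> real) \<Rightarrow> bool" where
  "C_k 0 f \<longleftrightarrow> continuous_on UNIV f"
| "C_k (Suc k) f \<longleftrightarrow> (\<forall>x. f differentiable (at x)) \<and> (\<forall>i. C_k k (partial i f))"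

definition test_function :: "(real^'d \<Rightarrow> real) \<Rightarrow> bool" where
  "test_function \<psi> \<longleftrightarrow> (\<forall>k. C_k k \<psi>) \<and> compact (closure (support_on UNIV \<psi>))"

definition L_infinity :: "(real^'d \<Rightarrow> real) set" where
  "L_infinity = {u. u \<in> borel_measurable lebesgue \<and> (\<exists>C. AE x in lebesgue. \<bar>u x\<bar> \<le> C)}"


section \<open>Measures on the punctured space\<close>

text \<open>Measures on the punctured space carry the space \<open>- {0}\<close>, so that \<open>0\<close> is not
  a point of the underlying space (as opposed to being a null set).\<close>

definition radon_measure_punctured :: "(real^'d) measure \<Rightarrow> bool" where
  "radon_measure_punctured \<mu> \<longleftrightarrow>
     sets \<mu> = sets (restrict_space borel (- {0})) \<and>
     (\<forall>K. compact K \<and> K \<subseteq> - {0} \<longrightarrow> emeasure \<mu> K < \<infinity>) \<and>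
     (\<forall>A \<in> sets \<mu>. emeasure \<mu> A = (SUP K \<in> {K. compact K \<and> K \<subseteq> A}. emeasure \<mu> K))"

definition levy_measure :: "(real^'d) measure \<Rightarrow> bool" where
  "levy_measure \<mu> \<longleftrightarrow> radon_measure_punctured \<mu> \<and>
     (\<integral>\<^sup>+ z. ennreal (min ((norm z)\<^sup>2) 1) \<partial>\<mu>) < \<infinity>"

definition reflected_measure :: "(real^'d) measure \<Rightarrow> (real^'d) measure" where
  "reflected_measure \<mu> = distr \<mu> \<mu> uminus"

text \<open>The ball has to be intersected with \<open>space \<mu> = - {0}\<close>: \<open>emeasure\<close> is \<open>0\<close> by convention
  on sets outside \<open>sets \<mu>\<close>, hence on every ball containing the origin.\<close>

definition msupp :: "(real^'d) measure \<Rightarrow> (real^'d) set" where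
  "msupp \<mu> = {z. z \<noteq> 0 \<and> (\<forall>r>0. emeasure \<mu> (ball z r \<inter> space \<mu>) > 0)}"


section \<open>Operators\<close>

definition local_op :: "real^'p^'d \<Rightarrow> real^'d \<Rightarrow> (real^'d \<Rightarrow> real) \<Rightarrow> real^'d \<Rightarrow> real" where
  "local_op \<sigma> b u x = trace (\<sigma> ** transpose \<sigma> ** hessian u x) + b \<bullet> grad u x"

definition nonlocal_op :: "(real^'d) measure \<Rightarrow> (real^'d \<Rightarrow> real) \<Rightarrow> real^'d \<Rightarrow> real" where
  "nonlocal_op \<mu> u x =
     (LINT z|\<mu>. u (x + z) - u x - (z \<bullet> grad u x) * indicator {z. norm z \<le> 1} z)"

definition levy_op ::
    "real^'p^'d \<Rightarrow> real^'d \<Rightarrow> (real^'d) measure \<Rightarrow> (real^'d \<Rightarrow> real) \<Rightarrow> real^'d \<Rightarrow> real" where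
  "levy_op \<sigma> b \<mu> u x = local_op \<sigma> b u x + nonlocal_op \<mu> u x"

definition adjoint_op ::
    "real^'p^'d \<Rightarrow> real^'d \<Rightarrow> (real^'d) measure \<Rightarrow> (real^'d \<Rightarrow> real) \<Rightarrow> real^'d \<Rightarrow> real" where
  "adjoint_op \<sigma> b \<mu> = levy_op \<sigma> (- b) (reflected_measure \<mu>)"

text \<open>The distribution \<open>\<L>[u]\<close>, as a functional on test functions.\<close>

definition levy_distribution ::
    "real^'p^'d \<Rightarrow> real^'d \<Rightarrow> (real^'d) measure \<Rightarrow> (real^'d \<Rightarrow> real) \<Rightarrow> (real^'d \<Rightarrow> real) \<Rightarrow> real" where
  "levy_distribution \<sigma> b \<mu> u \<psi> = (LINT x|lebesgue. u x * adjoint_op \<sigma> b \<mu> \<psi> x)"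


section \<open>Periodicity and the group of periods\<close>

definition ae_periodic :: "(real^'d) set \<Rightarrow> (real^'d \<Rightarrow> real) \<Rightarrow> bool" where
  "ae_periodic S u \<longleftrightarrow>
     (\<forall>s\<in>S. \<forall>\<psi>. test_function \<psi> \<longrightarrow> (LINT x|lebesgue. (u (x + s) - u x) * \<psi> x) = 0)"

definition G_mu :: "(real^'d) measure \<Rightarrow> (real^'d) set" where
  "G_mu \<mu> = closure (group_closure (msupp \<mu>))"

definition V_mu :: "(real^'d) measure \<Rightarrow> (real^'d) set" where
  "V_mu \<mu> = {g \<in> G_mu \<mu>. \<forall>t::real. t *\<^sub>R g \<in> G_mu \<mu>}"

definition c_mu :: "(real^'d) measure \<Rightarrow> real^'d" where
  "c_mu \<mu> = - (LINT z:({z. norm z \<le> 1} - V_mu \<mu>)|\<mu>. z)"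

definition W_space :: "real^'p^'d \<Rightarrow> real^'d \<Rightarrow> (real^'d) set" where
  "W_space \<sigma> c = span (columns \<sigma> \<union> {c})"

end

theory Submission
  imports Defs
begin

text \<open>
  Put \<open>U x = \<integral> u(y) \<psi>(y - x) dy\<close> for a test function \<open>\<psi>\<close>. By Fubini, \<open>\<L>[u] = 0\<close> says that the
  generator \<open>L\<close> annihilates all these functions, which are bounded and smooth, and \<open>u\<close> is
  \<open>s\<close>-periodic iff all of them are.

  From \<open>L(f\<^sup>2) = 2 f L f + \<Gamma>(f)\<close>, where
  \<open>\<Gamma>(f)(x) = 2 |\<sigma>\<^sup>T D f(x)|\<^sup>2 + \<integral> (f(x+z) - f(x))\<^sup>2 d\<mu>(z)\<close>,
  one gets \<open>L(f\<^sup>2 + l U\<^sup>2) \<ge> l \<Gamma>(U)\<close> whenever \<open>L f = L U = 0\<close>. By the maximum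
  principle \<open>\<Gamma>(U)\<close> is almost zero at almost-maximum points of \<open>f\<^sup>2 + l U\<^sup>2\<close>. If \<open>f\<close> is
  \<open>\<sigma>\<^sub>j \<cdot> D U\<close>, or \<open>U(\<cdot> + h) - U\<close> with \<open>h\<close> in the support of \<open>\<mu>\<close>, then \<open>f\<^sup>2\<close> is controlled there by
  \<open>\<Gamma>(U)\<close>, so \<open>sup f\<^sup>2 \<le> l sup U\<^sup>2\<close> for all \<open>l > 0\<close>, and \<open>f = 0\<close>. Hence \<open>u\<close> is
  \<open>G\<^sub>\<mu>\<close>-periodic and constant along the \<open>\<sigma>\<^sub>j\<close>, and \<open>L U = 0\<close> reduces to
  \<open>(b + c\<^sub>\<mu>) \<cdot> D U = 0\<close>. The integral defining \<open>c\<^sub>\<mu>\<close> converges because the points of a closed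
  subgroup outside its largest linear subspace stay away from \<open>0\<close>.
\<close>

section \<open>Test functions\<close>

text \<open>By linearity the Frechet derivative is determined by its values on the axes, which are
  the entries of \<open>grad\<close>. This ties \<open>partial\<close> to the derivative rules of
  the library.\<close>

lemma has_derivative_grad:
  fixes f :: "real^'d \<Rightarrow> real"
  assumes "f differentiable (at x)"
  shows "(f has_derivative (\<lambda>v. v \<bullet> grad f x)) (at x)"
proof -
  have d: "(f has_derivative frechet_derivative f (at x)) (at x)"
    using assms frechet_derivative_works by blast
  then have lin: "linear (frechet_derivative f (at x))"
    using has_derivative_linear by blast
  have "frechet_derivative f (at x) v = v \<bullet> grad f x" for v
  proof -
    have "v = (\<Sum>i\<in>UNIV. v $ i *\<^sub>R axis i 1)"
      by (simp add: basis_expansion scalar_mult_eq_scaleR [symmetric])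
    then have "frechet_derivative f (at x) v
        = (\<Sum>i\<in>UNIV. frechet_derivative f (at x) (v $ i *\<^sub>R axis i 1))"
      using linear_sum[OF lin] by metis
    then show ?thesis
      by (simp add: linear_scale[OF lin] inner_vec_def grad_def partial_def)
  qed
  then have "frechet_derivative f (at x) = (\<lambda>v. v \<bullet> grad f x)" by auto
  then show ?thesis using d by simp
qed

lemma partial_eqI:
  assumes "(f has_derivative f') (at x)"
  shows "partial i f x = f' (axis i 1)"
  using assms frechet_derivative_at unfolding partial_def by metis

lemma partial_add:
  assumes "f differentiable (at x)" "g differentiable (at x)"
  shows "partial i (\<lambda>y. f y + g y) x = partial i f x + partial i g x"
proof -
  have "((\<lambda>y. f y + g y) has_derivative (\<lambda>v. v \<bullet> grad f x + v \<bullet> grad g x)) (at x)"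
    using assms by (intro has_derivative_add has_derivative_grad)
  from partial_eqI[OF this] show ?thesis
    by (simp add: grad_def inner_axis')
qed

lemma partial_cmult:
  assumes "f differentiable (at x)"
  shows "partial i (\<lambda>y. c * f y) x = c * partial i f x"
proof -
  have "((\<lambda>y. c * f y) has_derivative (\<lambda>v. c * (v \<bullet> grad f x))) (at x)"
    using assms by (intro has_derivative_mult_right has_derivative_grad)
  from partial_eqI[OF this] show ?thesis
    by (simp add: grad_def inner_axis')
qed

lemma has_derivative_shift:
  fixes f :: "real^'d \<Rightarrow> real"
  assumes "f differentiable (at (x - a))"
  shows "((\<lambda>y. f (y - a)) has_derivative (\<lambda>v. v \<bullet> grad f (x - a))) (at x)"
  by (rule has_derivative_eq_rhs, rule diff_chain_at[unfolded comp_def, where f = "\<lambda>y. y - a" and g = f])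
     (auto intro!: derivative_eq_intros has_derivative_grad assms)

lemma partial_shift:
  fixes f :: "real^'d \<Rightarrow> real"
  assumes "f differentiable (at (x - a))"
  shows "partial i (\<lambda>y. f (y - a)) x = partial i f (x - a)"
  using partial_eqI[OF has_derivative_shift[OF assms], of i]
  by (simp add: grad_def inner_axis')

lemma C_k_add: "C_k k f \<Longrightarrow> C_k k g \<Longrightarrow> C_k k (\<lambda>x. f x + g x)"
proof (induction k arbitrary: f g)
  case 0
  then show ?case by (auto intro: continuous_on_add)
next
  case (Suc k)
  then have "partial i (\<lambda>x. f x + g x) = (\<lambda>x. partial i f x + partial i g x)" for i
    by (intro ext partial_add) auto
  then show ?case using Suc by auto
qed

lemma C_k_cmult: "C_k k f \<Longrightarrow> C_k k (\<lambda>x. c * f x)"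
proof (induction k arbitrary: f)
  case 0
  then show ?case by (auto intro: continuous_intros)
next
  case (Suc k)
  then have "partial i (\<lambda>x. c * f x) = (\<lambda>x. c * partial i f x)" for i
    by (intro ext partial_cmult) auto
  then show ?case using Suc by auto
qed

lemma C_k_shift:
  fixes f :: "real^'d \<Rightarrow> real"
  shows "C_k k f \<Longrightarrow> C_k k (\<lambda>x. f (x - a))"
proof (induction k arbitrary: f)
  case 0
  then show ?case
    by (auto intro!: continuous_on_compose2[of UNIV f UNIV "\<lambda>x. x - a"] continuous_intros)
next
  case (Suc k)
  then have "partial i (\<lambda>x. f (x - a)) = (\<lambda>x. partial i f (x - a))" for i
    by (intro ext partial_shift) auto
  moreover have "(\<lambda>x. f (x - a)) differentiable (at x)" for x
    using has_derivative_shift[of f x a] Suc.prems by (auto simp: differentiable_def)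
  ultimately show ?case using Suc by auto
qed

lemma test_function_C_k: "test_function f \<Longrightarrow> C_k k f"
  by (simp add: test_function_def)

lemma test_function_differentiable: "test_function f \<Longrightarrow> f differentiable (at x)"
  using test_function_C_k[of f "Suc 0"] by simp

lemma test_function_continuous: "test_function f \<Longrightarrow> continuous_on UNIV f"
  using test_function_C_k[of f 0] by simp

text \<open>In Euclidean space the closure of a set is compact iff the set is bounded. A radius
  beyond which the function vanishes is the form of compact support used from here on.\<close>

lemma test_function_iff_bounded:
  "test_function f \<longleftrightarrow> (\<forall>k. C_k k f) \<and> (\<exists>R>0. \<forall>x. norm x > R \<longrightarrow> f x = 0)"
proof -
  have "compact (closure (support_on UNIV f)) \<longleftrightarrow> bounded (support_on UNIV f)"
    by (simp add: compact_closure)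
  also have "\<dots> \<longleftrightarrow> (\<exists>R>0. \<forall>x. norm x > R \<longrightarrow> f x = 0)"
    by (auto simp: bounded_pos support_on_def not_less[symmetric])
  finally show ?thesis by (simp add: test_function_def)
qed

lemma test_function_add:
  assumes "test_function f" "test_function g"
  shows "test_function (\<lambda>x. f x + g x)"
proof -
  obtain R S where R: "R > 0" "\<And>x. norm x > R \<Longrightarrow> f x = 0"
    and S: "S > 0" "\<And>x. norm x > S \<Longrightarrow> g x = 0"
    using assms unfolding test_function_iff_bounded by blast
  have "\<exists>R>0. \<forall>x. norm x > R \<longrightarrow> f x + g x = 0"
    by (rule exI[of _ "max R S"]) (use R S in auto)
  then show ?thesis
    using assms C_k_add[of _ f g] unfolding test_function_iff_bounded by blast
qed

lemma test_function_cmult: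
  assumes "test_function f"
  shows "test_function (\<lambda>x. c * f x)"
  using assms C_k_cmult[of _ f c] unfolding test_function_iff_bounded by (metis mult_zero_right)

lemma test_function_shift:
  fixes f :: "real^'d \<Rightarrow> real"
  assumes "test_function f"
  shows "test_function (\<lambda>x. f (x - a))"
proof -
  obtain R where R: "R > 0" "\<And>x. norm x > R \<Longrightarrow> f x = 0"
    using assms unfolding test_function_iff_bounded by blast
  have "f (x - a) = 0" if "norm x > R + norm a" for x
    using that norm_triangle_sub[of x a] by (intro R(2)) linarith
  moreover have "R + norm a > 0" using R(1) by (simp add: add_pos_nonneg)
  ultimately have "\<exists>R>0. \<forall>x. norm x > R \<longrightarrow> f (x - a) = 0" by blast
  then show ?thesis
    using assms C_k_shift[of _ f a] unfolding test_function_iff_bounded by blast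
qed

lemma test_function_partial:
  fixes f :: "real^'d \<Rightarrow> real"
  assumes "test_function f"
  shows "test_function (partial i f)"
proof -
  obtain R where R: "R > 0" "\<And>x. norm x > R \<Longrightarrow> f x = 0"
    using assms unfolding test_function_iff_bounded by blast
  have "partial i f x = 0" if "norm x > R" for x
  proof -
    \<comment> \<open>The exterior of the closed ball is open, so \<open>f\<close> agrees with 0
      near \<open>x\<close>.\<close>
    have "(f has_derivative (\<lambda>v. 0)) (at x)"
    proof (rule has_derivative_transform_within_open[where f = "\<lambda>x. 0" and s = "{x. R < norm x}"])
      show "open {x::real^'d. R < norm x}"
        by (intro open_Collect_less continuous_intros)
    qed (use that R in auto)
    from partial_eqI[OF this] show ?thesis .
  qed
  moreover have "C_k k (partial i f)" for k
    using test_function_C_k[OF assms, of "Suc k"] by simp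
  ultimately show ?thesis using R(1) unfolding test_function_iff_bounded by blast
qed

lemma test_function_sum:
  fixes f :: "'i \<Rightarrow> real^'d \<Rightarrow> real"
  assumes "finite A" "\<And>i. i \<in> A \<Longrightarrow> test_function (f i)"
  shows "test_function (\<lambda>x. \<Sum>i\<in>A. f i x)"
  using assms
proof (induction A)
  case empty
  have "C_k k (\<lambda>x::real^'d. 0::real)" for k
  proof (induction k)
    case (Suc k)
    have "partial i (\<lambda>x::real^'d. 0::real) = (\<lambda>x. 0)" for i
      by (intro ext partial_eqI[of _ "\<lambda>v. 0", simplified]) auto
    then show ?case using Suc by auto
  qed auto
  then show ?case by (auto simp: test_function_iff_bounded intro: exI[of _ 1])
next
  case (insert a A)
  then show ?case by (simp add: test_function_add)
qed

section \<open>Directional derivatives and the second-order Taylor estimate for test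
  functions\<close>

definition dirderiv :: "real^'d \<Rightarrow> (real^'d \<Rightarrow> real) \<Rightarrow> real^'d \<Rightarrow> real" where
  "dirderiv v f x = v \<bullet> grad f x"

lemma dirderiv_sum: "dirderiv v f x = (\<Sum>i\<in>UNIV. v $ i * partial i f x)"
  by (simp add: dirderiv_def inner_vec_def grad_def)

lemma test_function_dirderiv: "test_function f \<Longrightarrow> test_function (dirderiv v f)"
  unfolding dirderiv_sum[abs_def]
  by (intro test_function_sum test_function_cmult test_function_partial) auto

lemma dirderiv_shift:
  "test_function f \<Longrightarrow> dirderiv v (\<lambda>y. f (y - a)) x = dirderiv v f (x - a)"
  by (simp add: dirderiv_sum partial_shift test_function_differentiable)

lemma dirderiv_has_real_derivative:
  assumes "test_function f"
  shows "((\<lambda>t. f (x + t *\<^sub>R v)) has_real_derivative dirderiv v f (x + t *\<^sub>R v)) (at t)"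
proof -
  have "((\<lambda>t. f (x + t *\<^sub>R v)) has_derivative (\<lambda>s. (s *\<^sub>R v) \<bullet> grad f (x + t *\<^sub>R v))) (at t)"
    by (rule diff_chain_at[unfolded comp_def, where f = "\<lambda>t. x + t *\<^sub>R v" and g = f])
       (auto intro!: derivative_eq_intros has_derivative_grad test_function_differentiable assms)
  then show ?thesis
    unfolding has_field_derivative_def dirderiv_def by (simp add: mult_commute_abs)
qed

lemma test_function_bounded:
  assumes "test_function f"
  obtains B where "B \<ge> 0" "\<And>x. \<bar>f x\<bar> \<le> B"
proof -
  obtain R where R: "R > 0" "\<And>x. norm x > R \<Longrightarrow> f x = 0"
    using assms unfolding test_function_iff_bounded by blast
  have "compact (f ` cball 0 R)"
    using test_function_continuous[OF assms]
    by (intro compact_continuous_image) (auto intro: continuous_on_subset)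
  then have "bounded (f ` cball 0 R)"
    by (rule compact_imp_bounded)
  then obtain B where B: "B > 0" "\<And>x. norm x \<le> R \<Longrightarrow> \<bar>f x\<bar> \<le> B"
    unfolding bounded_pos by auto
  show thesis
  proof (rule that[of B])
    show "\<bar>f x\<bar> \<le> B" for x
      using B R(2)[of x] by (cases "norm x \<le> R") auto
  qed (use B in auto)
qed

text \<open>For fixed \<open>v\<close>, \<open>dirderiv v f\<close> is a constant-coefficient
  combination of the partial derivatives, so it is differentiated term by term. The result is the
  quadratic form of the Hessian.\<close>

lemma dirderiv2_sum:
  assumes "test_function f"
  shows "dirderiv v (dirderiv v f) x = (\<Sum>i\<in>UNIV. \<Sum>j\<in>UNIV. v $ i * v $ j * partial j (partial i f) x)"
proof -
  have "((\<lambda>y. \<Sum>i\<in>UNIV. v $ i * partial i f y) has_derivative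
      (\<lambda>w. \<Sum>i\<in>UNIV. v $ i * (w \<bullet> grad (partial i f) x))) (at x)"
    using assms
    by (intro has_derivative_sum has_derivative_mult_right has_derivative_grad
        test_function_differentiable test_function_partial)
  then have *: "(dirderiv v f has_derivative
      (\<lambda>w. \<Sum>i\<in>UNIV. v $ i * (w \<bullet> grad (partial i f) x))) (at x)"
    by (simp add: dirderiv_sum[abs_def])
  have "dirderiv v (dirderiv v f) x = (\<Sum>i\<in>UNIV. v $ i * (v \<bullet> grad (partial i f) x))"
    using fun_cong[OF has_derivative_unique[OF has_derivative_grad *], of v]
      test_function_differentiable[OF test_function_dirderiv[OF assms]]
    by (simp only: dirderiv_def[of v "dirderiv v f"])
  then show ?thesis
    by (simp add: inner_vec_def grad_def sum_distrib_left mult.assoc)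
qed

text \<open>Second partials are again test functions, hence bounded. Since the components of
  \<open>v\<close> are at most \<open>norm v\<close>, the sum of these bounds serves all directions
  at once.\<close>

lemma dirderiv2_bounded:
  assumes "test_function f"
  obtains B where "B \<ge> 0" "\<And>v x. \<bar>dirderiv v (dirderiv v f) x\<bar> \<le> B * (norm v)\<^sup>2"
proof -
  have "\<forall>i. \<forall>j. \<exists>B\<ge>0. \<forall>x. \<bar>partial j (partial i f) x\<bar> \<le> B"
    using test_function_bounded[OF test_function_partial[OF test_function_partial[OF assms]]] by metis
  then obtain B where B: "\<And>i j. B i j \<ge> 0" "\<And>i j x. \<bar>partial j (partial i f) x\<bar> \<le> B i j"
    unfolding choice_iff by blast
  show thesis
  proof
    show "(\<Sum>i\<in>UNIV. \<Sum>j\<in>UNIV. B i j) \<ge> 0" by (intro sum_nonneg B)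
    fix v x
    have "\<bar>dirderiv v (dirderiv v f) x\<bar> \<le> (\<Sum>i\<in>UNIV. \<Sum>j\<in>UNIV. \<bar>v $ i * v $ j * partial j (partial i f) x\<bar>)"
      unfolding dirderiv2_sum[OF assms] by (intro order_trans[OF sum_abs] sum_mono) auto
    also have "\<dots> \<le> (\<Sum>i\<in>UNIV. \<Sum>j\<in>UNIV. (norm v * norm v) * B i j)"
      unfolding abs_mult by (intro sum_mono mult_mono B component_le_norm_cart) auto
    finally show "\<bar>dirderiv v (dirderiv v f) x\<bar> \<le> (\<Sum>i\<in>UNIV. \<Sum>j\<in>UNIV. B i j) * (norm v)\<^sup>2"
      by (simp add: sum_distrib_left sum_distrib_right power2_eq_square mult.commute)
  qed
qed

text \<open>The mean value theorem is applied twice along the segment, first to \<open>f\<close>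
  minus its linear part and then to the derivative. This loses only the factor 1/2 of the sharp
  remainder.\<close>

lemma taylor2:
  assumes "test_function f" and B: "\<And>v x. \<bar>dirderiv v (dirderiv v f) x\<bar> \<le> B * (norm v)\<^sup>2"
  shows "\<bar>f (x + z) - f x - dirderiv z f x\<bar> \<le> B * (norm z)\<^sup>2"
proof -
  have "\<exists>t::real. 0 < t \<and> t < 1 \<and> (f (x + 1 *\<^sub>R z) - 1 * dirderiv z f x) - (f (x + 0 *\<^sub>R z) - 0 * dirderiv z f x)
      = (1 - 0) * (dirderiv z f (x + t *\<^sub>R z) - dirderiv z f x)"
    by (rule MVT2) (auto intro!: derivative_eq_intros dirderiv_has_real_derivative assms(1))
  then obtain t :: real where t: "0 < t" "t < 1"
    "f (x + z) - f x - dirderiv z f x = dirderiv z f (x + t *\<^sub>R z) - dirderiv z f x"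
    by auto
  have "\<exists>s::real. 0 < s \<and> s < t \<and> dirderiv z f (x + t *\<^sub>R z) - dirderiv z f (x + 0 *\<^sub>R z)
      = (t - 0) * dirderiv z (dirderiv z f) (x + s *\<^sub>R z)"
    using t(1)
    by (rule MVT2) (auto intro!: dirderiv_has_real_derivative test_function_dirderiv assms(1))
  then obtain s where s: "dirderiv z f (x + t *\<^sub>R z) - dirderiv z f x
      = t * dirderiv z (dirderiv z f) (x + s *\<^sub>R z)"
    by auto
  have "t * \<bar>dirderiv z (dirderiv z f) (x + s *\<^sub>R z)\<bar> \<le> 1 * (B * (norm z)\<^sup>2)"
    using t B by (intro mult_mono) auto
  then show ?thesis using s t by (simp add: abs_mult)
qed

section \<open>Functions with bounded second-order Taylor expansion\<close>

text \<open>\<open>D x v\<close> and \<open>E x v\<close> are the first and second derivatives at \<open>x\<close> in direction \<open>v\<close>; the Taylor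
  estimate makes the Levy integrand of \<open>f\<close> integrable, uniformly in the base point.\<close>

definition C2_bounded ::
    "('a::euclidean_space \<Rightarrow> real) \<Rightarrow> ('a \<Rightarrow> 'a \<Rightarrow> real) \<Rightarrow> ('a \<Rightarrow> 'a \<Rightarrow> real) \<Rightarrow> real \<Rightarrow> bool" where
  "C2_bounded f D E B \<longleftrightarrow>
     (\<forall>x. \<bar>f x\<bar> \<le> B) \<and> (\<forall>x. linear (D x)) \<and>
     (\<forall>x v. \<bar>D x v\<bar> \<le> B * norm v) \<and> (\<forall>x v. \<bar>E x v\<bar> \<le> B * (norm v)\<^sup>2) \<and>
     (\<forall>x z. norm z \<le> 1 \<longrightarrow> \<bar>f (x + z) - f x - D x z\<bar> \<le> B * (norm z)\<^sup>2) \<and>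
     (\<forall>x v. ((\<lambda>t. D (x + t *\<^sub>R v) v) has_real_derivative E x v) (at 0))"

lemma C2_boundedD:
  assumes "C2_bounded f D E B"
  shows "\<bar>f x\<bar> \<le> B" "linear (D x)" "\<bar>D x v\<bar> \<le> B * norm v" "\<bar>E x v\<bar> \<le> B * (norm v)\<^sup>2"
    "norm z \<le> 1 \<Longrightarrow> \<bar>f (x + z) - f x - D x z\<bar> \<le> B * (norm z)\<^sup>2"
    "((\<lambda>t. D (x + t *\<^sub>R v) v) has_real_derivative E x v) (at 0)"
    "B \<ge> 0"
proof -
  have "0 \<le> \<bar>f x\<bar>" by simp
  also have "\<bar>f x\<bar> \<le> B" using assms by (auto simp: C2_bounded_def)
  finally show "B \<ge> 0" .
qed (use assms in \<open>auto simp: C2_bounded_def\<close>)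

lemma has_derivative_quadratic:
  fixes f :: "'a::real_normed_vector \<Rightarrow> real"
  assumes L: "bounded_linear L"
    and quad: "\<And>h. norm h \<le> 1 \<Longrightarrow> \<bar>f (x + h) - f x - L h\<bar> \<le> B * (norm h)\<^sup>2"
  shows "(f has_derivative L) (at x)"
proof -
  have "((\<lambda>h. norm (f (x + h) - f x - L h) / norm h) \<longlongrightarrow> 0) (at 0)"
  proof (rule Lim_null_comparison)
    show "\<forall>\<^sub>F h in at 0. norm (norm (f (x + h) - f x - L h) / norm h) \<le> B * norm h"
      unfolding eventually_at
    proof (intro exI[of _ 1] conjI ballI impI)
      fix h :: 'a assume "h \<noteq> 0 \<and> dist h 0 < 1"
      then show "norm (norm (f (x + h) - f x - L h) / norm h) \<le> B * norm h"
        using quad[of h] by (simp add: field_simps power2_eq_square)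
    qed simp
    show "((\<lambda>h. B * norm h) \<longlongrightarrow> 0) (at (0::'a))"
      by (auto intro!: tendsto_eq_intros)
  qed
  then show ?thesis using L by (simp add: has_derivative_at)
qed

text \<open>The Taylor conjunct of \<open>C2_bounded\<close> already contains differentiability: the
  remainder is quadratic on the unit ball.\<close>

lemma C2_bounded_has_derivative:
  assumes "C2_bounded f D E B"
  shows "(f has_derivative D x) (at x)"
  using C2_boundedD(2,5)[OF assms]
  by (intro has_derivative_quadratic) (auto simp: linear_conv_bounded_linear)

lemma C2_bounded_line_derivative:
  assumes "C2_bounded f D E B"
  shows "((\<lambda>t. f (x + t *\<^sub>R v)) has_real_derivative D (x + t *\<^sub>R v) v) (at t)"
proof -
  have "((\<lambda>t. f (x + t *\<^sub>R v)) has_derivative (\<lambda>s. D (x + t *\<^sub>R v) (s *\<^sub>R v))) (at t)"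
    by (rule diff_chain_at[unfolded comp_def, where f = "\<lambda>t. x + t *\<^sub>R v" and g = f])
       (auto intro!: derivative_eq_intros C2_bounded_has_derivative[OF assms])
  then show ?thesis
    unfolding has_field_derivative_def
    using linear_scale[OF C2_boundedD(2)[OF assms]] by (simp add: mult_commute_abs)
qed

lemma C2_bounded_continuous: "C2_bounded f D E B \<Longrightarrow> continuous_on UNIV f"
  using C2_bounded_has_derivative has_derivative_continuous by (metis continuous_at_imp_continuous_on)

lemma linear_borel_measurable: "linear (g :: 'a::euclidean_space \<Rightarrow> real) \<Longrightarrow> g \<in> borel_measurable borel"
  by (intro borel_measurable_continuous_onI linear_continuous_on) (simp add: linear_conv_bounded_linear)

text \<open>The linear term and the Taylor remainder each contribute at most
  \<open>B * norm z\<close>, because the square of a norm at most 1 does not exceed the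
  norm.\<close>

lemma C2_bounded_lipschitz:
  assumes "C2_bounded f D E B" and z: "norm z \<le> 1"
  shows "\<bar>f (x + z) - f x\<bar> \<le> 2 * B * norm z"
proof -
  note nD = C2_boundedD[OF assms(1)]
  have "B * (norm z)\<^sup>2 \<le> B * norm z"
    using z nD(7) by (intro mult_left_mono) (auto simp: power2_eq_square mult_left_le)
  then show ?thesis using nD(3)[of x z] nD(5)[OF z, of x] by linarith
qed

lemma C2_bounded_add:
  assumes f: "C2_bounded f D E B" and g: "C2_bounded g D' E' B'"
  shows "C2_bounded (\<lambda>x. f x + g x) (\<lambda>x v. D x v + D' x v) (\<lambda>x v. E x v + E' x v) (B + B')"
proof -
  note F = C2_boundedD[OF f] and G = C2_boundedD[OF g]
  show ?thesis
    unfolding C2_bounded_def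
  proof (intro conjI allI impI)
    show "\<bar>f x + g x\<bar> \<le> B + B'" for x using F(1)[of x] G(1)[of x] by linarith
    show "linear (\<lambda>v. D x v + D' x v)" for x by (intro linear_compose_add F G)
    show "\<bar>D x v + D' x v\<bar> \<le> (B + B') * norm v" for x v
      using F(3)[of x v] G(3)[of x v] unfolding distrib_right by linarith
    show "\<bar>E x v + E' x v\<bar> \<le> (B + B') * (norm v)\<^sup>2" for x v
      using F(4)[of x v] G(4)[of x v] unfolding distrib_right by linarith
    show "\<bar>f (x + z) + g (x + z) - (f x + g x) - (D x z + D' x z)\<bar> \<le> (B + B') * (norm z)\<^sup>2"
      if "norm z \<le> 1" for x z
      using F(5)[OF that, of x] G(5)[OF that, of x] unfolding distrib_right by linarith
    show "((\<lambda>t. D (x + t *\<^sub>R v) v + D' (x + t *\<^sub>R v) v) has_real_derivative E x v + E' x v) (at 0)" for x v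
      by (intro DERIV_add F G)
  qed
qed

lemma C2_bounded_cmult:
  assumes f: "C2_bounded f D E B"
  shows "C2_bounded (\<lambda>x. c * f x) (\<lambda>x v. c * D x v) (\<lambda>x v. c * E x v) (\<bar>c\<bar> * B)"
proof -
  note F = C2_boundedD[OF f]
  have *: "\<bar>c * a\<bar> \<le> \<bar>c\<bar> * B * r" if "\<bar>a\<bar> \<le> B * r" for a r
    using that by (simp add: abs_mult mult.assoc mult_left_mono)
  show ?thesis
    unfolding C2_bounded_def
  proof (intro conjI allI impI)
    show "\<bar>c * f x\<bar> \<le> \<bar>c\<bar> * B" for x using *[of "f x" 1] F(1)[of x] by simp
    show "linear (\<lambda>v. c * D x v)" for x
      using linear_compose_scale_right[OF F(2), of c x] by simp
    show "\<bar>c * f (x + z) - c * f x - c * D x z\<bar> \<le> \<bar>c\<bar> * B * (norm z)\<^sup>2"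
      if "norm z \<le> 1" for x z
      using *[OF F(5)[OF that, of x]] by (simp add: algebra_simps)
    show "((\<lambda>t. c * D (x + t *\<^sub>R v) v) has_real_derivative c * E x v) (at 0)" for x v
      by (intro DERIV_cmult F)
  qed (intro * F)+
qed

text \<open>The Bernstein argument applies the generator to squares. The constant is dictated by the
  Taylor remainder: 4 from the squared Lipschitz bound and 2 from the product of
  \<open>2 * f x\<close> with the remainder of \<open>f\<close>.\<close>

lemma C2_bounded_square:
  assumes f: "C2_bounded f D E B"
  shows "C2_bounded (\<lambda>x. (f x)\<^sup>2) (\<lambda>x v. 2 * f x * D x v)
    (\<lambda>x v. 2 * (D x v)\<^sup>2 + 2 * f x * E x v) (6 * B\<^sup>2)"
proof -
  note F = C2_boundedD[OF f]
  have sq: "a\<^sup>2 \<le> C\<^sup>2" if "\<bar>a\<bar> \<le> C" for a C :: real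
    using that by (metis abs_le_square_iff abs_of_nonneg order_trans abs_ge_zero)
  have prod: "\<bar>2 * f x * a\<bar> \<le> 2 * B\<^sup>2 * r" if "\<bar>a\<bar> \<le> B * r" for a r x
    using mult_mono[OF F(1) that F(7)] by (auto simp: abs_mult power2_eq_square mult_ac)
  show ?thesis
    unfolding C2_bounded_def
  proof (intro conjI allI impI)
    show "\<bar>(f x)\<^sup>2\<bar> \<le> 6 * B\<^sup>2" for x using sq[OF F(1)[of x]] zero_le_power2[of B] unfolding abs_power2 by linarith
    show "linear (\<lambda>v. 2 * f x * D x v)" for x
      using linear_compose_scale_right[OF F(2)[of x], of "2 * f x"] by simp
    have *: "2 * B\<^sup>2 * r \<le> 6 * B\<^sup>2 * r" if "r \<ge> 0" for r
      using that by (intro mult_right_mono) auto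
    show "\<bar>2 * f x * D x v\<bar> \<le> 6 * B\<^sup>2 * norm v" for x v
      using prod[OF F(3)[of x v], of x] *[of "norm v"] by simp
    show "\<bar>2 * (D x v)\<^sup>2 + 2 * f x * E x v\<bar> \<le> 6 * B\<^sup>2 * (norm v)\<^sup>2" for x v
    proof -
      have "0 \<le> B\<^sup>2 * (norm v)\<^sup>2" by simp
      then show ?thesis
        using prod[OF F(4)[of x v], of x] sq[OF F(3)[of x v]] zero_le_power2[of "D x v"]
        unfolding power_mult_distrib by linarith
    qed
    show "\<bar>(f (x + z))\<^sup>2 - (f x)\<^sup>2 - 2 * f x * D x z\<bar> \<le> 6 * B\<^sup>2 * (norm z)\<^sup>2"
      if z: "norm z \<le> 1" for x z
    proof -
      have "(f (x + z))\<^sup>2 - (f x)\<^sup>2 - 2 * f x * D x z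
          = (f (x + z) - f x)\<^sup>2 + 2 * f x * (f (x + z) - f x - D x z)"
        by (simp add: algebra_simps power2_eq_square)
      moreover have "(f (x + z) - f x)\<^sup>2 \<le> 4 * (B\<^sup>2 * (norm z)\<^sup>2)"
        using sq[OF C2_bounded_lipschitz[OF f z, of x]] by (simp add: power_mult_distrib)
      moreover have "0 \<le> (f (x + z) - f x)\<^sup>2" by simp
      moreover have "\<bar>2 * f x * (f (x + z) - f x - D x z)\<bar> \<le> 2 * (B\<^sup>2 * (norm z)\<^sup>2)"
        using prod[OF F(5)[OF z, of x], of x] by simp
      ultimately show ?thesis unfolding mult.assoc[of 6] by linarith
    qed
    show "((\<lambda>t. 2 * f (x + t *\<^sub>R v) * D (x + t *\<^sub>R v) v) has_real_derivative
       2 * (D x v)\<^sup>2 + 2 * f x * E x v) (at 0)" for x v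
      using C2_bounded_line_derivative[OF f, of x v 0] F(6)[of x v]
      by (auto intro!: derivative_eq_intros simp: power2_eq_square)
  qed
qed

text \<open>A rational profile with maximum 1 at \<open>a\<close> that decays to 0 at infinity and
  whose derivatives are explicit and bounded.\<close>

definition bump :: "'a::euclidean_space \<Rightarrow> 'a \<Rightarrow> real" where
  "bump a x = 1 / (1 + (norm (x - a))\<^sup>2)"

text \<open>The two functions are the chain-rule derivatives of 1/s with s = 1 + |x - a|^2. The
  constant is 2 + 8, from the two terms of the second derivative; the Taylor remainder only asks for
  1 + 4 + 2.\<close>

lemma C2_bounded_bump:
  fixes a :: "'a::euclidean_space"
  shows "C2_bounded (bump a)
    (\<lambda>x v. - 2 * ((x - a) \<bullet> v) / (1 + (norm (x - a))\<^sup>2)\<^sup>2)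
    (\<lambda>x v. - 2 * (norm v)\<^sup>2 / (1 + (norm (x - a))\<^sup>2)\<^sup>2 + 8 * ((x - a) \<bullet> v)\<^sup>2 / (1 + (norm (x - a))\<^sup>2)^3) 10"
proof -
  have pos: "1 + (norm y)\<^sup>2 > 0" "1 + (norm y)\<^sup>2 \<ge> 1" for y :: 'a
    by (simp_all add: add_pos_nonneg)
  have i1: "(y \<bullet> v)\<^sup>2 \<le> (1 + (norm y)\<^sup>2) * (norm v)\<^sup>2" for y v :: 'a
  proof -
    have "(y \<bullet> v)\<^sup>2 \<le> (norm y)\<^sup>2 * (norm v)\<^sup>2"
      using Cauchy_Schwarz_ineq[of y v] by (simp add: power2_norm_eq_inner)
    then show ?thesis using zero_le_power2[of "norm v"] unfolding distrib_right mult_1 by linarith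
  qed
  have i2: "\<bar>y \<bullet> v\<bar> \<le> (1 + (norm y)\<^sup>2) * norm v" for y v :: 'a
  proof -
    have "norm y \<le> 1 + (norm y)\<^sup>2"
    proof -
      have "2 * norm y \<le> (norm y)\<^sup>2 + 1" using sum_squares_bound[of "norm y" 1] by simp
      then show ?thesis using norm_ge_zero[of y] by linarith
    qed
    then show ?thesis
      using Cauchy_Schwarz_ineq2[of y v] mult_right_mono[of "norm y" "1 + (norm y)\<^sup>2" "norm v"] by simp
  qed
  \<comment> \<open>Bounds a quotient through a lower bound \<open>t\<close> of its denominator;
    below, \<open>t\<close> is 1 or 1 + |x - a|^2.\<close>
  have q: "\<bar>r / s\<bar> \<le> c" if "\<bar>r\<bar> \<le> c * t" "t \<le> s" "t > 0" "c \<ge> 0" for r s c t :: real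
  proof -
    have "\<bar>r\<bar> \<le> c * s" using that mult_left_mono[of t s c] by linarith
    then show ?thesis using that by (simp add: divide_le_eq)
  qed
  show ?thesis
    unfolding C2_bounded_def bump_def
  proof (intro conjI allI impI)
    fix x v :: 'a
    define y where "y = x - a"
    define s where "s = 1 + (norm y)\<^sup>2"
    have s: "s \<ge> 1" "s \<le> s\<^sup>2" "s^3 = s * s\<^sup>2" "s \<le> s^3"
      using pos[of y] self_le_power[of s 2] self_le_power[of s 3] unfolding s_def
      by (auto simp: power2_eq_square power3_eq_cube)
    show "\<bar>1 / (1 + (norm (x - a))\<^sup>2)\<bar> \<le> 10"
      using pos[of "x - a"] by (simp add: divide_le_eq)
    show "linear (\<lambda>v. - 2 * ((x - a) \<bullet> v) / (1 + (norm (x - a))\<^sup>2)\<^sup>2)"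
      by (rule linearI) (auto simp: inner_add_right distrib_left add_divide_distrib diff_divide_distrib)
    show "\<bar>- 2 * ((x - a) \<bullet> v) / (1 + (norm (x - a))\<^sup>2)\<^sup>2\<bar> \<le> 10 * norm v"
      unfolding y_def[symmetric] s_def[symmetric]
      using i2[of y v] s by (intro q[of _ _ s]) (auto simp: s_def[symmetric] abs_mult mult_ac)
    show "\<bar>- 2 * (norm v)\<^sup>2 / (1 + (norm (x - a))\<^sup>2)\<^sup>2 + 8 * ((x - a) \<bullet> v)\<^sup>2 / (1 + (norm (x - a))\<^sup>2) ^ 3\<bar>
        \<le> 10 * (norm v)\<^sup>2"
    proof -
      have "\<bar>- 2 * (norm v)\<^sup>2 / s\<^sup>2\<bar> \<le> 2 * (norm v)\<^sup>2"
        using s by (intro q[of _ _ 1]) auto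
      moreover have "\<bar>8 * (y \<bullet> v)\<^sup>2 / s ^ 3\<bar> \<le> 8 * (norm v)\<^sup>2"
        using s i1[of y v] by (intro q[of _ _ s]) (auto simp: s_def[symmetric] mult_ac)
      ultimately show ?thesis unfolding y_def[symmetric] s_def[symmetric] by linarith
    qed
    show "((\<lambda>t. - 2 * ((x + t *\<^sub>R v - a) \<bullet> v) / (1 + (norm (x + t *\<^sub>R v - a))\<^sup>2)\<^sup>2) has_real_derivative
       - 2 * (norm v)\<^sup>2 / (1 + (norm (x - a))\<^sup>2)\<^sup>2 + 8 * ((x - a) \<bullet> v)\<^sup>2 / (1 + (norm (x - a))\<^sup>2)^3) (at 0)"
    proof -
      have 1: "(x + t *\<^sub>R v - a) \<bullet> v = y \<bullet> v + t * (norm v)\<^sup>2" for t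
        by (simp add: y_def algebra_simps inner_add_left inner_diff_left power2_norm_eq_inner)
      have 2: "(norm (x + t *\<^sub>R v - a))\<^sup>2 = (norm y)\<^sup>2 + 2 * t * (y \<bullet> v) + t\<^sup>2 * (norm v)\<^sup>2" for t
        unfolding y_def power2_norm_eq_inner
        by (simp add: algebra_simps inner_simps inner_commute power2_eq_square)
      have s0: "1 + (norm y)\<^sup>2 = s" "s \<noteq> 0" using s(1) by (simp add: s_def, linarith)
      show ?thesis
        unfolding 1 2 y_def[symmetric]
        apply (rule derivative_eq_intros refl | simp add: s0)+
        using s0(2) by (simp add: field_simps eval_nat_numeral)
    qed
  next
    fix x z :: 'a assume z: "norm z \<le> 1"
    define y where "y = x - a"
    define s where "s = 1 + (norm y)\<^sup>2"
    define r where "r = 1 + (norm (y + z))\<^sup>2"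
    define p where "p = y \<bullet> z"
    define n where "n = (norm z)\<^sup>2"
    have s: "s \<ge> 1" "r \<ge> 1" using pos by (auto simp: s_def r_def)
    have rs: "r = s + 2 * p + n"
      unfolding r_def s_def p_def n_def power2_norm_eq_inner
      by (simp add: inner_simps inner_commute)
    have n: "0 \<le> n" "n \<le> 1" using z by (auto simp: n_def power_le_one)
    have p1: "p\<^sup>2 \<le> s * n" unfolding p_def s_def n_def by (rule i1)
    have p2: "\<bar>p\<bar> \<le> s"
    proof -
      have "\<bar>p\<bar> \<le> s * norm z" unfolding p_def s_def by (rule i2)
      also have "\<dots> \<le> s * 1" using z s by (intro mult_left_mono) auto
      finally show ?thesis by simp
    qed
    \<comment> \<open>Over the common denominator the first-order terms cancel. What remains is
      quadratic in \<open>z\<close>: the three terms are at most \<open>n\<close>,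
      \<open>4 * n\<close> and \<open>2 * n\<close>.\<close>
    have "1 / r - 1 / s - (- 2 * p / s\<^sup>2) = - n / (s * r) + 4 * p\<^sup>2 / (s\<^sup>2 * r) + 2 * p * n / (s\<^sup>2 * r)"
      using s unfolding rs by (simp add: divide_simps) (simp add: algebra_simps power2_eq_square power3_eq_cube)
    moreover have "\<bar>- n / (s * r)\<bar> \<le> n"
      using s n mult_mono[of 1 s 1 r] by (intro q[of _ _ 1]) auto
    moreover have sr: "s \<le> s\<^sup>2 * r"
      using s mult_mono[of s "s\<^sup>2" 1 r] by (auto simp: self_le_power)
    then have "\<bar>4 * p\<^sup>2 / (s\<^sup>2 * r)\<bar> \<le> 4 * n"
      using s n p1 by (intro q[of _ _ s]) (auto simp: mult_ac)
    moreover have "\<bar>2 * p * n / (s\<^sup>2 * r)\<bar> \<le> 2 * n"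
      using s n sr mult_right_mono[OF p2 n(1)] by (intro q[of _ _ s]) (auto simp: abs_mult mult_ac)
    ultimately have "\<bar>1 / r - 1 / s - (- 2 * p / s\<^sup>2)\<bar> \<le> 10 * n"
      using n by linarith
    then show "\<bar>1 / (1 + (norm (x + z - a))\<^sup>2) - 1 / (1 + (norm (x - a))\<^sup>2) -
        - 2 * ((x - a) \<bullet> z) / (1 + (norm (x - a))\<^sup>2)\<^sup>2\<bar> \<le> 10 * (norm z)\<^sup>2"
      by (simp add: r_def s_def p_def n_def y_def algebra_simps)
  qed
qed

section \<open>The generator and Bernstein's method\<close>

text \<open>The columns of the matrix appear as a finite family of vectors, so that the second-order
  part is a sum of second directional derivatives.\<close>

locale levy_generator =
  fixes \<mu> :: "'a::euclidean_space measure" and \<sigma> :: "'p::finite \<Rightarrow> 'a" and b :: 'a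
  assumes sets_mu: "sets \<mu> = sets (restrict_space borel (- {0}))"
    and integrable_min: "integrable \<mu> (\<lambda>z. min ((norm z)\<^sup>2) 1)"
begin

abbreviation mass :: real where "mass \<equiv> LINT z|\<mu>. min ((norm z)\<^sup>2) 1"

abbreviation increment :: "('a \<Rightarrow> real) \<Rightarrow> ('a \<Rightarrow> 'a \<Rightarrow> real) \<Rightarrow> 'a \<Rightarrow> 'a \<Rightarrow> real" where
  "increment f D x z \<equiv> f (x + z) - f x - D x z * indicator {z. norm z \<le> 1} z"

text \<open>The operator itself, not its adjoint. Derivatives are passed as data, so sums, multiples
  and squares come with explicit derivatives of their own.\<close>

definition gen :: "('a \<Rightarrow> real) \<Rightarrow> ('a \<Rightarrow> 'a \<Rightarrow> real) \<Rightarrow> ('a \<Rightarrow> 'a \<Rightarrow> real) \<Rightarrow> 'a \<Rightarrow> real" where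
  "gen f D E x = (\<Sum>j\<in>UNIV. E x (\<sigma> j)) + D x b + (LINT z|\<mu>. increment f D x z)"

definition carre :: "('a \<Rightarrow> real) \<Rightarrow> ('a \<Rightarrow> 'a \<Rightarrow> real) \<Rightarrow> 'a \<Rightarrow> real" where
  "carre f D x = 2 * (\<Sum>j\<in>UNIV. (D x (\<sigma> j))\<^sup>2) + (LINT z|\<mu>. (f (x + z) - f x)\<^sup>2)"

lemma borel_measurable_mu: "g \<in> borel_measurable borel \<Longrightarrow> g \<in> borel_measurable \<mu>"
  using measurable_restrict_space1[of g borel borel "- {0}"] measurable_cong_sets[OF sets_mu refl] by blast

lemma space_mu: "space \<mu> = - {0}"
  using sets_eq_imp_space_eq[OF sets_mu] by (simp add: space_restrict_space)

lemma mass_nonneg: "mass \<ge> 0"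
  by (intro integral_nonneg_AE) auto

text \<open>The common source of integrability against \<open>\<mu>\<close>: quadratic decay at the
  origin and boundedness away from it.\<close>

lemma dominated_by_min:
  fixes g :: "'a \<Rightarrow> real"
  assumes "g \<in> borel_measurable borel" "\<And>z. \<bar>g z\<bar> \<le> C * min ((norm z)\<^sup>2) 1"
  shows "integrable \<mu> g" "\<bar>LINT z|\<mu>. g z\<bar> \<le> C * mass"
proof -
  have i: "integrable \<mu> (\<lambda>z. C * min ((norm z)\<^sup>2) 1)"
    using integrable_min by simp
  show *: "integrable \<mu> g"
    by (rule Bochner_Integration.integrable_bound[OF i])
       (auto intro!: borel_measurable_mu assms order_trans[OF assms(2)])
  have "\<bar>LINT z|\<mu>. g z\<bar> \<le> (LINT z|\<mu>. \<bar>g z\<bar>)"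
    using integral_abs_bound by blast
  also have "\<dots> \<le> (LINT z|\<mu>. C * min ((norm z)\<^sup>2) 1)"
    using * i assms by (intro integral_mono) auto
  finally show "\<bar>LINT z|\<mu>. g z\<bar> \<le> C * mass" by simp
qed

lemma C2_bounded_shift_measurable:
  assumes "C2_bounded f D E B"
  shows "(\<lambda>z. f (x + z)) \<in> borel_measurable borel"
  using C2_bounded_continuous[OF assms]
  by (intro borel_measurable_continuous_onI continuous_on_compose2[of UNIV f UNIV "\<lambda>z. x + z"])
     (auto intro: continuous_intros)

text \<open>In the unit ball this is the Taylor estimate. Outside, the compensator is switched off
  and two values of \<open>f\<close> remain, whence the factor 2.\<close>

lemma increment_bound:
  assumes "C2_bounded f D E B"
  shows "\<bar>increment f D x z\<bar> \<le> 2 * B * min ((norm z)\<^sup>2) 1"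
proof (cases "norm z \<le> 1")
  case True
  then have "(norm z)\<^sup>2 \<le> 1" by (simp add: power_le_one)
  moreover have "0 \<le> B * (norm z)\<^sup>2" using C2_boundedD(7)[OF assms] by simp
  ultimately show ?thesis using True C2_boundedD(5)[OF assms True, of x]
    by (simp add: min_absorb1)
next
  case False
  then have "(norm z)\<^sup>2 \<ge> 1" by (simp add: one_le_power)
  then show ?thesis using False C2_boundedD(1)[OF assms, of x] C2_boundedD(1)[OF assms, of "x + z"]
    by (simp add: min_absorb2)
qed

lemma increment_measurable:
  assumes "C2_bounded f D E B"
  shows "increment f D x \<in> borel_measurable borel"
  using C2_bounded_shift_measurable[OF assms, of x]
    linear_borel_measurable[OF C2_boundedD(2)[OF assms, of x]]
  by (intro borel_measurable_diff borel_measurable_times borel_measurable_indicator) auto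

lemma increment_integrable:
  assumes "C2_bounded f D E B"
  shows "integrable \<mu> (increment f D x)" "\<bar>LINT z|\<mu>. increment f D x z\<bar> \<le> 2 * B * mass"
  using dominated_by_min[OF increment_measurable[OF assms] increment_bound[OF assms]] by blast+

text \<open>The increment is at most \<open>2 * B * min (norm z) 1\<close>, Lipschitz near 0 and
  bounded far away, so its square is dominated by the integrable weight.\<close>

lemma square_increment_integrable:
  assumes "C2_bounded f D E B"
  shows "integrable \<mu> (\<lambda>z. (f (x + z) - f x)\<^sup>2)"
proof (rule dominated_by_min)
  show "(\<lambda>z. (f (x + z) - f x)\<^sup>2) \<in> borel_measurable borel"
    using C2_bounded_shift_measurable[OF assms, of x] by measurable
  fix z
  note B = C2_boundedD(7)[OF assms]
  have "\<bar>f (x + z) - f x\<bar> \<le> 2 * B * min (norm z) 1"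
    using C2_bounded_lipschitz[OF assms, of z x]
      C2_boundedD(1)[OF assms, of x] C2_boundedD(1)[OF assms, of "x + z"]
    by (cases "norm z \<le> 1") auto
  then have "\<bar>f (x + z) - f x\<bar>\<^sup>2 \<le> (2 * B * min (norm z) 1)\<^sup>2"
    by (intro power_mono) auto
  also have "\<dots> = 4 * B\<^sup>2 * (min (norm z) 1)\<^sup>2" by (simp add: power_mult_distrib)
  also have "(min (norm z) 1)\<^sup>2 = min ((norm z)\<^sup>2) 1"
    by (cases "norm z \<le> 1") (auto simp: min_def power_le_one not_le one_less_power dest: power_le_imp_le_base
      abs_square_le_1[THEN iffD1])
  finally show "\<bar>(f (x + z) - f x)\<^sup>2\<bar> \<le> 4 * B\<^sup>2 * min ((norm z)\<^sup>2) 1" by simp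
qed

text \<open>All contributions to the carre du champ are nonnegative, so smallness of the whole
  passes to each of them.\<close>

lemma carre_bounds:
  assumes "C2_bounded f D E B"
  shows "2 * (D x (\<sigma> j))\<^sup>2 \<le> carre f D x" "(LINT z|\<mu>. (f (x + z) - f x)\<^sup>2) \<le> carre f D x"
proof -
  have 1: "(D x (\<sigma> j))\<^sup>2 \<le> (\<Sum>j\<in>UNIV. (D x (\<sigma> j))\<^sup>2)"
    by (rule member_le_sum) auto
  have 2: "(LINT z|\<mu>. (f (x + z) - f x)\<^sup>2) \<ge> 0" by (intro integral_nonneg_AE) auto
  have 3: "(\<Sum>j\<in>UNIV. (D x (\<sigma> j))\<^sup>2) \<ge> 0" by (intro sum_nonneg) auto
  show "2 * (D x (\<sigma> j))\<^sup>2 \<le> carre f D x" using 1 2 unfolding carre_def by linarith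
  show "(LINT z|\<mu>. (f (x + z) - f x)\<^sup>2) \<le> carre f D x" using 3 unfolding carre_def by linarith
qed

section \<open>Linearity and product rule of the generator\<close>

lemma gen_add:
  assumes f: "C2_bounded f D E B" and g: "C2_bounded g D' E' B'"
  shows "gen (\<lambda>x. f x + g x) (\<lambda>x v. D x v + D' x v) (\<lambda>x v. E x v + E' x v) x
    = gen f D E x + gen g D' E' x"
proof -
  have "(LINT z|\<mu>. increment (\<lambda>x. f x + g x) (\<lambda>x v. D x v + D' x v) x z)
      = (LINT z|\<mu>. increment f D x z + increment g D' x z)"
    by (intro Bochner_Integration.integral_cong) (auto simp: algebra_simps)
  then show ?thesis
    by (simp add: gen_def sum.distrib increment_integrable[OF f] increment_integrable[OF g])
qed

lemma gen_cmult:
  assumes f: "C2_bounded f D E B"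
  shows "gen (\<lambda>x. c * f x) (\<lambda>x v. c * D x v) (\<lambda>x v. c * E x v) x = c * gen f D E x"
proof -
  have "(LINT z|\<mu>. increment (\<lambda>x. c * f x) (\<lambda>x v. c * D x v) x z)
      = (LINT z|\<mu>. c * increment f D x z)"
    by (intro Bochner_Integration.integral_cong) (auto simp: algebra_simps)
  also have "\<dots> = c * (LINT z|\<mu>. increment f D x z)" by simp
  finally show ?thesis
    unfolding gen_def distrib_left sum_distrib_left by simp
qed

text \<open>In the jump part, a^2 - c^2 = (a - c)^2 + 2c(a - c) is applied under the integral. The
  second-order terms produce the squares of the derivatives, and the drift obeys the Leibniz rule
  exactly.\<close>

lemma gen_square:
  assumes f: "C2_bounded f D E B"
  shows "gen (\<lambda>x. (f x)\<^sup>2) (\<lambda>x v. 2 * f x * D x v) (\<lambda>x v. 2 * (D x v)\<^sup>2 + 2 * f x * E x v) x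
    = 2 * f x * gen f D E x + carre f D x"
proof -
  have "(LINT z|\<mu>. increment (\<lambda>x. (f x)\<^sup>2) (\<lambda>x v. 2 * f x * D x v) x z)
      = (LINT z|\<mu>. (f (x + z) - f x)\<^sup>2 + 2 * f x * increment f D x z)"
    by (intro Bochner_Integration.integral_cong) (auto simp: algebra_simps power2_eq_square)
  also have "\<dots> = (LINT z|\<mu>. (f (x + z) - f x)\<^sup>2) + 2 * f x * (LINT z|\<mu>. increment f D x z)"
    using square_increment_integrable[OF f] increment_integrable[OF f] by simp
  finally show ?thesis
    unfolding gen_def carre_def distrib_left sum_distrib_left sum.distrib by simp
qed

text \<open>The bound is uniform in \<open>x\<close>; it makes a perturbation by a small multiple of
  \<open>bump\<close> harmless.\<close>

lemma gen_bound:
  assumes f: "C2_bounded f D E B"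
  shows "\<bar>gen f D E x\<bar> \<le> B * ((\<Sum>j\<in>UNIV. (norm (\<sigma> j))\<^sup>2) + norm b + 2 * mass)"
proof -
  have "\<bar>\<Sum>j\<in>UNIV. E x (\<sigma> j)\<bar> \<le> (\<Sum>j\<in>UNIV. B * (norm (\<sigma> j))\<^sup>2)"
    by (rule order_trans[OF sum_abs]) (intro sum_mono C2_boundedD(4)[OF f])
  then show ?thesis
    using C2_boundedD(3)[OF f, of x b] increment_integrable(2)[OF f, of x]
    unfolding gen_def distrib_left sum_distrib_left by (simp add: mult_ac)
qed

section \<open>Maximum principle\<close>

lemma gen_nonpos_at_max:
  assumes f: "C2_bounded f D E B" and max: "\<And>y. f y \<le> f x"
  shows "gen f D E x \<le> 0"
proof -
  have D0: "D x v = 0" for v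
  proof -
    have "((\<lambda>t. f (x + t *\<^sub>R v)) has_real_derivative D x v) (at 0)"
      using C2_bounded_line_derivative[OF f, of x v 0] by simp
    then show ?thesis by (rule DERIV_local_max[of _ _ _ 1]) (auto intro: max)
  qed
  \<comment> \<open>A positive second derivative, with vanishing first derivative, would make
    \<open>f\<close> strictly increasing for a short while along \<open>v\<close>.\<close>
  have E0: "E x v \<le> 0" for v
  proof (rule ccontr)
    assume "\<not> E x v \<le> 0"
    then obtain d where d: "d > 0" "\<And>h. 0 < h \<Longrightarrow> h < d \<Longrightarrow> D (x + 0 *\<^sub>R v) v < D (x + (0 + h) *\<^sub>R v) v"
      using DERIV_pos_inc_right[OF C2_boundedD(6)[OF f, of x v]] by auto
    have "f (x + 0 *\<^sub>R v) < f (x + (d / 2) *\<^sub>R v)"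
    proof (rule DERIV_pos_imp_increasing_open[where f = "\<lambda>t. f (x + t *\<^sub>R v)"])
      show "\<exists>y. ((\<lambda>t. f (x + t *\<^sub>R v)) has_real_derivative y) (at t) \<and> 0 < y"
        if "0 < t" "t < d / 2" for t
        using C2_bounded_line_derivative[OF f, of x v t] d(2)[of t] D0 that by auto
      show "continuous_on {0..d / 2} (\<lambda>t. f (x + t *\<^sub>R v))"
        by (intro continuous_on_compose2[OF C2_bounded_continuous[OF f]] continuous_intros) auto
    qed (use d in auto)
    then show False using max[of "x + (d / 2) *\<^sub>R v"] by simp
  qed
  have "(\<Sum>j\<in>UNIV. E x (\<sigma> j)) \<le> 0" by (intro sum_nonpos E0)
  \<comment> \<open>The jump term compares \<open>f x\<close> with values at every distance; this is
    where the maximum has to be global.\<close>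
  moreover have "(LINT z|\<mu>. increment f D x z) \<le> (LINT z|\<mu>. 0)"
    using D0 max by (intro integral_mono increment_integrable[OF f]) auto
  ultimately show ?thesis using D0 by (simp add: gen_def)
qed

text \<open>Adding a small multiple of a bump centred at a near-maximum makes the supremum attained.\<close>

lemma approximate_maximum_principle:
  assumes w: "C2_bounded w D E B" and \<delta>: "\<delta> > 0"
  shows "\<exists>x. (\<forall>y. w y \<le> w x + \<delta>) \<and> gen w D E x \<le> \<delta>"
proof -
  \<comment> \<open>\<open>K\<close> bounds the generator of any \<open>bump\<close>, by
    \<open>gen_bound\<close> with the constant 10. The choice of \<open>\<eta>\<close> keeps both
    the bump term and its generator below \<open>\<delta>\<close>.\<close>
  define K where "K = 10 * ((\<Sum>j\<in>UNIV. (norm (\<sigma> j))\<^sup>2) + norm b + 2 * mass)"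
  have K: "K \<ge> 0" unfolding K_def using mass_nonneg by (simp add: sum_nonneg)
  define \<eta> where "\<eta> = \<delta> / (K + 1)"
  have \<eta>: "\<eta> > 0" "\<eta> \<le> \<delta>" "\<eta> * K \<le> \<delta>"
    using \<delta> K by (auto simp: \<eta>_def field_simps)
  define M where "M = Sup (range w)"
  have bdd: "bdd_above (range w)"
    using C2_boundedD(1)[OF w] by (intro bdd_aboveI[of _ B]) (auto simp: abs_le_iff)
  have le_M: "w y \<le> M" for y unfolding M_def by (intro cSup_upper bdd) auto
  obtain a where a: "w a > M - \<eta>"
    using less_cSup_iff[of "range w" "M - \<eta>"] bdd \<eta>(1) by (auto simp: M_def)
  define W where "W = (\<lambda>x. w x + \<eta> * bump a x)"
  note bump = C2_bounded_bump[of a]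
  note \<eta>bump = C2_bounded_cmult[OF bump, of \<eta>]
  note W = C2_bounded_add[OF w \<eta>bump, folded W_def]
  have bump01: "0 \<le> bump a x" "bump a x \<le> 1" for x
    by (simp_all add: bump_def divide_le_eq add_pos_nonneg)
  \<comment> \<open>Since \<open>bump a a = 1\<close> and \<open>w a > M - \<eta>\<close>, the
    perturbed value at \<open>a\<close> exceeds the supremum of \<open>w\<close> by
    \<open>e > 0\<close>. Beyond the radius \<open>R\<close> below, the bump term is at most
    \<open>e\<close>, so \<open>W\<close> cannot exceed \<open>W a\<close> there and compactness of
    the ball yields a global maximum.\<close>
  define e where "e = W a - M"
  have e: "e > 0" using a by (simp add: e_def W_def bump_def)
  define R where "R = sqrt (\<eta> / e)"
  have far: "W x \<le> W a" if "norm (x - a) > R" for x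
  proof -
    have "R\<^sup>2 \<le> (norm (x - a))\<^sup>2"
      using that e \<eta> by (intro power_mono) (auto simp: R_def)
    then have "\<eta> / e \<le> 1 + (norm (x - a))\<^sup>2"
      using e \<eta> by (simp add: R_def)
    then have "\<eta> * bump a x \<le> e"
      using e by (simp add: bump_def divide_le_eq mult.commute add_pos_nonneg)
    then show ?thesis using le_M[of x] by (simp add: W_def e_def)
  qed
  have "\<exists>x\<in>cball a R. \<forall>y\<in>cball a R. W y \<le> W x"
  proof (rule continuous_attains_sup)
    show "cball a R \<noteq> {}" using divide_pos_pos[OF \<eta>(1) e] by (simp add: R_def)
    show "continuous_on (cball a R) W"
      using C2_bounded_continuous[OF W] continuous_on_subset by blast
  qed auto
  then obtain x where x: "\<And>y. norm (y - a) \<le> R \<Longrightarrow> W y \<le> W x"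
    unfolding mem_cball dist_norm Ball_def by (metis norm_minus_commute)
  have Wmax: "W y \<le> W x" for y
  proof (cases "norm (y - a) \<le> R")
    case False
    then have "W y \<le> W a" using far by auto
    also have "\<dots> \<le> W x" using divide_pos_pos[OF \<eta>(1) e] by (intro x) (simp add: R_def)
    finally show ?thesis .
  qed (use x in auto)
  have "w y \<le> w x + \<delta>" for y
  proof -
    have "\<eta> * bump a x \<le> \<eta> * 1" using \<eta> bump01 by (intro mult_left_mono) auto
    moreover have "0 \<le> \<eta> * bump a y" using \<eta> bump01 by simp
    ultimately show ?thesis using Wmax[of y] \<eta>(2) by (simp add: W_def)
  qed
  moreover have "gen w D E x \<le> \<delta>"
  proof -
    let ?g = "gen (bump a) (\<lambda>x v. - 2 * ((x - a) \<bullet> v) / (1 + (norm (x - a))\<^sup>2)\<^sup>2)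
      (\<lambda>x v. - 2 * (norm v)\<^sup>2 / (1 + (norm (x - a))\<^sup>2)\<^sup>2
        + 8 * ((x - a) \<bullet> v)\<^sup>2 / (1 + (norm (x - a))\<^sup>2)^3) x"
    have "gen w D E x + \<eta> * ?g \<le> 0"
      using gen_nonpos_at_max[OF W Wmax] gen_add[OF w \<eta>bump, of x] gen_cmult[OF bump, of \<eta> x]
      by (simp add: W_def)
    moreover have "\<bar>\<eta> * ?g\<bar> \<le> \<eta> * K"
      using gen_bound[OF bump, of x] \<eta>(1) unfolding abs_mult K_def by (intro mult_mono) auto
    ultimately show ?thesis using \<eta>(3) by linarith
  qed
  ultimately show ?thesis by blast
qed

text \<open>Bernstein's method: the generator of \<open>f\<^sup>2 + l g\<^sup>2\<close> is at least \<open>l\<close> times the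
  carre du champ of \<open>g\<close>, which is therefore small where that function is almost maximal.\<close>

lemma bernstein:
  assumes f: "C2_bounded f D E B" and g: "C2_bounded g D' E' B'"
    and "\<And>x. gen f D E x = 0" "\<And>x. gen g D' E' x = 0" and l: "l > 0" and \<delta>: "\<delta> > 0"
  shows "\<exists>x. (\<forall>y. (f y)\<^sup>2 \<le> (f x)\<^sup>2 + l * B'\<^sup>2 + \<delta>) \<and> carre g D' x \<le> \<delta>"
proof -
  note f2 = C2_bounded_square[OF f] and g2 = C2_bounded_square[OF g]
  note lg2 = C2_bounded_cmult[OF g2, of l]
  \<comment> \<open>The tolerance is \<open>\<delta>\<close> for almost-maximality and
    \<open>l * \<delta>\<close> for the generator, because the carre du champ of \<open>g\<close>
    appears with the factor \<open>l\<close>.\<close>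
  have "min \<delta> (l * \<delta>) > 0" using l \<delta> by simp
  from approximate_maximum_principle[OF C2_bounded_add[OF f2 lg2] this]
  obtain x where x: "\<And>y. (f y)\<^sup>2 + l * (g y)\<^sup>2 \<le> (f x)\<^sup>2 + l * (g x)\<^sup>2 + min \<delta> (l * \<delta>)"
    "carre f D x + l * carre g D' x \<le> min \<delta> (l * \<delta>)"
    using assms(3,4)
    by (auto simp: gen_add[OF f2 lg2] gen_cmult[OF g2] gen_square[OF f] gen_square[OF g])
  have "(f y)\<^sup>2 \<le> (f x)\<^sup>2 + l * B'\<^sup>2 + \<delta>" for y
  proof -
    have "\<bar>g x\<bar>\<^sup>2 \<le> B'\<^sup>2" using C2_boundedD(1)[OF g] by (intro power_mono) auto
    then have "l * (g x)\<^sup>2 \<le> l * B'\<^sup>2" using l by simp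
    moreover have "0 \<le> l * (g y)\<^sup>2" using l by simp
    ultimately show ?thesis using x(1)[of y] by linarith
  qed
  moreover have "carre g D' x \<le> \<delta>"
  proof -
    \<comment> \<open>\<open>undefined\<close> stands for an arbitrary column index; one exists
      because types are inhabited.\<close>
    have "0 \<le> carre f D x" using carre_bounds(1)[OF f, of x undefined] zero_le_power2 by (smt (verit))
    then have "l * carre g D' x \<le> l * \<delta>" using x(2) by linarith
    then show ?thesis using l by simp
  qed
  ultimately show ?thesis by blast
qed

section \<open>Vanishing of column derivatives and of increments over the support\<close>

lemma square_le_all_imp_zero:
  fixes r C :: real
  assumes "\<And>\<epsilon>. \<epsilon> > 0 \<Longrightarrow> r\<^sup>2 \<le> \<epsilon> * C" "C > 0"
  shows "r = 0"
proof (rule ccontr)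
  assume "r \<noteq> 0"
  then have "r\<^sup>2 > 0" by simp
  \<comment> \<open>With this choice of \<open>\<epsilon>\<close> the hypothesis says that
    \<open>r\<^sup>2\<close> is at most half of itself.\<close>
  then have "r\<^sup>2 \<le> r\<^sup>2 / (2 * C) * C" using assms(2) by (intro assms(1)) auto
  then show False using \<open>r\<^sup>2 > 0\<close> assms(2) by simp
qed

text \<open>Twice the square of the column derivative is part of the carre du champ of
  \<open>g\<close>. At the point from \<open>bernstein\<close> it is therefore at most
  \<open>\<epsilon>\<close>, which bounds the derivative everywhere by a multiple of
  \<open>\<epsilon>\<close>.\<close>

lemma diffusion_derivative_zero:
  assumes g: "C2_bounded g D E B" and f: "C2_bounded (\<lambda>x. D x (\<sigma> j)) D' E' B'"
    and "\<And>x. gen g D E x = 0" "\<And>x. gen (\<lambda>x. D x (\<sigma> j)) D' E' x = 0"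
  shows "D y (\<sigma> j) = 0"
proof (rule square_le_all_imp_zero)
  fix \<epsilon> :: real assume \<epsilon>: "\<epsilon> > 0"
  obtain x where x: "(D y (\<sigma> j))\<^sup>2 \<le> (D x (\<sigma> j))\<^sup>2 + \<epsilon> * B\<^sup>2 + \<epsilon>" "carre g D x \<le> \<epsilon>"
    using bernstein[OF f g assms(4,3) \<epsilon> \<epsilon>] by blast
  then show "(D y (\<sigma> j))\<^sup>2 \<le> \<epsilon> * (B\<^sup>2 + 2)"
    using carre_bounds(1)[OF g, of x j] \<epsilon> by (simp add: algebra_simps)
qed (simp add: add_nonneg_pos)

text \<open>Chebyshev's inequality: on \<open>A\<close> the integrable weight is at least
  \<open>min (r\<^sup>2) 1\<close>.\<close>

lemma emeasure_finite_away:
  assumes "r > 0" "A \<in> sets \<mu>" "\<And>z. z \<in> A \<Longrightarrow> norm z \<ge> r"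
  shows "emeasure \<mu> A < \<infinity>"
proof -
  define c where "c = min (r\<^sup>2) 1"
  have c: "c > 0" using assms by (simp add: c_def)
  have "integrable \<mu> (\<lambda>z. min ((norm z)\<^sup>2) 1 / c)" using integrable_min by simp
  then have "integrable \<mu> (\<lambda>z. indicator A z :: real)"
  proof (rule Bochner_Integration.integrable_bound)
    show "AE z in \<mu>. norm (indicator A z :: real) \<le> norm (min ((norm z)\<^sup>2) 1 / c)"
    proof (rule AE_I2)
      fix z
      have "c \<le> min ((norm z)\<^sup>2) 1" if "z \<in> A"
        unfolding c_def using power_mono[OF assms(3)[OF that], of 2] assms(1)
        by (intro min.mono) auto
      then show "norm (indicator A z :: real) \<le> norm (min ((norm z)\<^sup>2) 1 / c)"
        using c by (auto simp: indicator_def)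
    qed
  qed (use assms in simp)
  then show ?thesis using assms(2) by (simp add: integrable_indicator_iff)
qed

text \<open>The carre du champ controls only an integral of squared increments. A small ball around
  \<open>h\<close> has positive finite mass, and on it the increments by \<open>z\<close> and by
  \<open>h\<close> differ little, so the increment by \<open>h\<close> is controlled as
  well.\<close>

lemma jump_increment_zero:
  assumes g: "C2_bounded g D E B" and f: "C2_bounded (\<lambda>x. g (x + h) - g x) D' E' B'"
    and "\<And>x. gen g D E x = 0" "\<And>x. gen (\<lambda>x. g (x + h) - g x) D' E' x = 0"
    and h: "h \<noteq> 0" "\<And>r. r > 0 \<Longrightarrow> emeasure \<mu> (ball h r \<inter> space \<mu>) > 0"
  shows "g (y + h) - g y = 0"
proof (rule square_le_all_imp_zero)
  fix \<epsilon> :: real assume \<epsilon>: "\<epsilon> > 0"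
  note B = C2_boundedD(7)[OF g]
  \<comment> \<open>The three bounds allow the Lipschitz estimate, keep the ball away from 0, where
    the mass may be infinite, and make \<open>8 * B\<^sup>2 * r\<^sup>2\<close> at most
    \<open>\<epsilon>\<close>. The summand 1 covers \<open>B = 0\<close>.\<close>
  define r where "r = min 1 (min (norm h / 2) (\<epsilon> / (8 * B\<^sup>2 + 1)))"
  have r: "r > 0" "r \<le> 1" "r \<le> norm h / 2"
  proof -
    show "r > 0" using h(1) \<epsilon> B by (simp add: r_def add_nonneg_pos)
    show "r \<le> norm h / 2" unfolding r_def by linarith
  qed (simp add: r_def)
  have r\<epsilon>: "8 * B\<^sup>2 * r\<^sup>2 \<le> \<epsilon>"
  proof -
    have "r\<^sup>2 \<le> r * 1" using r by (simp add: power2_eq_square)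
    also have "r \<le> \<epsilon> / (8 * B\<^sup>2 + 1)" by (simp add: r_def)
    finally have "8 * B\<^sup>2 * r\<^sup>2 \<le> (8 * B\<^sup>2 + 1) * (\<epsilon> / (8 * B\<^sup>2 + 1))"
      by (intro mult_mono) auto
    also have "\<dots> = \<epsilon>" using zero_le_power2[of B] by (simp add: add_nonneg_eq_0_iff)
    finally show ?thesis .
  qed
  define A where "A = ball h r \<inter> space \<mu>"
  have A: "A \<in> sets \<mu>"
    unfolding A_def sets_mu space_mu by (auto simp: sets_restrict_space Int_commute)
  have fin: "emeasure \<mu> A < \<infinity>"
  proof (rule emeasure_finite_away)
    show "norm z \<ge> norm h / 2" if "z \<in> A" for z
    proof -
      have "norm (h - z) < norm h / 2" using that r by (auto simp: A_def dist_norm)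
      then show ?thesis using norm_triangle_sub[of h z] by linarith
    qed
  qed (use h A in auto)
  define p where "p = measure \<mu> A"
  have p: "p > 0"
    using h(2)[OF r(1)] fin unfolding p_def A_def[symmetric] measure_def by (simp add: enn2real_positive_iff)
  have iA: "integrable \<mu> (indicator A :: _ \<Rightarrow> real)" using fin A by (simp add: integrable_indicator_iff)
  \<comment> \<open>The factor \<open>p\<close> anticipates the later division by the mass of
    \<open>A\<close>.\<close>
  have pos: "min \<epsilon> (\<epsilon> * p) > 0" using \<epsilon> p by simp
  obtain x where x: "(g (y + h) - g y)\<^sup>2 \<le> (g (x + h) - g x)\<^sup>2 + \<epsilon> * B\<^sup>2 + min \<epsilon> (\<epsilon> * p)"
      "carre g D x \<le> min \<epsilon> (\<epsilon> * p)"
    using bernstein[OF f g assms(4,3) \<epsilon> pos] by blast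
  \<comment> \<open>The increment by \<open>h\<close> is split at \<open>x + z\<close>, using (a +
    c)^2 / 2 \<le> a^2 + c^2.\<close>
  have pt: "((g (x + h) - g x)\<^sup>2 / 2) * indicator A z \<le> (g (x + z) - g x)\<^sup>2 + 4 * B\<^sup>2 * r\<^sup>2 * indicator A z" for z
  proof (cases "z \<in> A")
    case True
    then have hz: "norm (h - z) < r" by (auto simp: A_def dist_norm)
    have "\<bar>g ((x + z) + (h - z)) - g (x + z)\<bar> \<le> 2 * B * norm (h - z)"
      using hz r by (intro C2_bounded_lipschitz[OF g]) auto
    also have "\<dots> \<le> 2 * B * r" using hz B by (intro mult_left_mono) auto
    finally have "\<bar>g (x + h) - g (x + z)\<bar>\<^sup>2 \<le> (2 * B * r)\<^sup>2" by (intro power_mono) auto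
    then have 1: "(g (x + h) - g (x + z))\<^sup>2 \<le> 4 * B\<^sup>2 * r\<^sup>2" by (simp add: power_mult_distrib)
    have "(a + c)\<^sup>2 / 2 \<le> a\<^sup>2 + c\<^sup>2" for a c :: real
      using sum_squares_bound[of a c] by (simp add: power2_sum)
    from this[of "g (x + h) - g (x + z)" "g (x + z) - g x"] 1 True show ?thesis by simp
  qed simp
  have "(g (x + h) - g x)\<^sup>2 / 2 * p \<le> (LINT z|\<mu>. (g (x + z) - g x)\<^sup>2) + 4 * B\<^sup>2 * r\<^sup>2 * p"
  proof -
    have "(LINT z|\<mu>. ((g (x + h) - g x)\<^sup>2 / 2) * indicator A z)
        \<le> (LINT z|\<mu>. (g (x + z) - g x)\<^sup>2 + 4 * B\<^sup>2 * r\<^sup>2 * indicator A z)"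
      using iA square_increment_integrable[OF g]
      by (intro integral_mono pt Bochner_Integration.integrable_add integrable_mult_right) auto
    also have "\<dots> = (LINT z|\<mu>. (g (x + z) - g x)\<^sup>2) + (LINT z|\<mu>. 4 * B\<^sup>2 * r\<^sup>2 * indicator A z)"
      using iA square_increment_integrable[OF g]
      by (intro Bochner_Integration.integral_add integrable_mult_right) auto
    finally show ?thesis using iA A fin sets.Int_space_eq2[OF A] by (simp add: p_def)
  qed
  also have "\<dots> \<le> \<epsilon> * p + 4 * B\<^sup>2 * r\<^sup>2 * p"
    using carre_bounds(2)[OF g, of x] x(2) by simp
  finally have "(g (x + h) - g x)\<^sup>2 / 2 * p \<le> (\<epsilon> + 4 * B\<^sup>2 * r\<^sup>2) * p" by (simp add: algebra_simps)
  then have "(g (x + h) - g x)\<^sup>2 / 2 \<le> \<epsilon> + 4 * B\<^sup>2 * r\<^sup>2" using p by simp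
  then have "(g (x + h) - g x)\<^sup>2 \<le> 3 * \<epsilon>" using r\<epsilon> by simp
  then show "(g (y + h) - g y)\<^sup>2 \<le> \<epsilon> * (B\<^sup>2 + 4)"
    using x(1) by (simp add: algebra_simps)
qed (simp add: add_nonneg_pos)

end

section \<open>Correlations with test functions\<close>

lemma test_function_measurable: "test_function \<psi> \<Longrightarrow> \<psi> \<in> borel_measurable borel"
  by (intro borel_measurable_continuous_onI test_function_continuous)

text \<open>Explicit in \<open>B\<close> and \<open>R\<close>, so that a pointwise bound of order
  |z|^2 for a family with common support carries over to its L1 norms.\<close>

lemma test_function_abs_integral_le:
  fixes \<psi> :: "real^'d \<Rightarrow> real"
  assumes "test_function \<psi>" "\<And>x. \<bar>\<psi> x\<bar> \<le> B" "\<And>x. norm x > R \<Longrightarrow> \<psi> x = 0"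
  shows "integrable lborel \<psi>" "(LINT x|lborel. \<bar>\<psi> x\<bar>) \<le> B * measure lborel (cball (0::real^'d) R)"
proof -
  have i: "integrable lborel (\<lambda>x. B * indicator (cball (0::real^'d) R) x)"
    using emeasure_lborel_cball_finite[of "0::real^'d" R]
    by (intro integrable_mult_right) (simp add: integrable_indicator_iff)
  have le: "\<bar>\<psi> x\<bar> \<le> B * indicator (cball 0 R) x" for x
    using assms(2)[of x] assms(3)[of x] by (auto simp: indicator_def)
  show *: "integrable lborel \<psi>"
    using test_function_measurable[OF assms(1)]
    by (intro Bochner_Integration.integrable_bound[OF i])
       (auto intro!: AE_I2 order_trans[OF le])
  have "(LINT x|lborel. \<bar>\<psi> x\<bar>) \<le> (LINT x|lborel. B * indicator (cball (0::real^'d) R) x)"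
    using * i le by (intro integral_mono) auto
  then show "(LINT x|lborel. \<bar>\<psi> x\<bar>) \<le> B * measure lborel (cball (0::real^'d) R)" by simp
qed

lemma test_function_integrable:
  assumes "test_function \<psi>"
  shows "integrable lborel \<psi>"
  using assms test_function_bounded[OF assms] test_function_abs_integral_le(1)[OF assms]
  unfolding test_function_iff_bounded by metis

lemma lborel_integral_shift:
  fixes g :: "'a::euclidean_space \<Rightarrow> real"
  assumes "g \<in> borel_measurable borel"
  shows "(LINT y|lborel. g (y - a)) = (LINT y|lborel. g y)"
proof -
  have "(LINT y|lborel. g y) = (LINT y|distr lborel borel ((+) (- a)). g y)"
    by (simp only: lborel_distr_plus)
  also have "\<dots> = (LINT y|lborel. g (y - a))"
    using assms by (subst integral_distr) auto
  finally show ?thesis by simp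
qed

text \<open>The Levy integrand at \<open>- z\<close>: correlating it with \<open>u\<close> gives the increment of \<open>corr \<psi>\<close> by \<open>z\<close>.\<close>

definition levy_kernel :: "(real^'d \<Rightarrow> real) \<Rightarrow> real^'d \<Rightarrow> real^'d \<Rightarrow> real" where
  "levy_kernel \<psi> z y = \<psi> (y - z) - \<psi> y + dirderiv z \<psi> y * indicator {z. norm z \<le> 1} z"

lemma test_function_levy_kernel:
  assumes "test_function \<psi>"
  shows "test_function (levy_kernel \<psi> z)"
proof -
  have "test_function (\<lambda>y. (\<psi> (y - z) + (- 1) * \<psi> y) + indicator {z. norm z \<le> 1} z * dirderiv z \<psi> y)"
    by (intro test_function_add test_function_cmult test_function_shift test_function_dirderiv assms)
  then show ?thesis by (simp add: levy_kernel_def[abs_def] mult.commute)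
qed

lemma dirderiv_uminus: "dirderiv (- v) f x = - dirderiv v f x"
  by (simp add: dirderiv_def)

text \<open>For \<open>norm z \<le> 1\<close> the Taylor estimate applies, and shifting by
  \<open>z\<close> enlarges the support by at most 1. For larger \<open>z\<close> only two
  translates of \<open>\<psi>\<close> remain, and Lebesgue measure is translation invariant.\<close>

lemma levy_kernel_L1:
  fixes \<psi> :: "real^'d \<Rightarrow> real"
  assumes "test_function \<psi>"
  obtains A where "A \<ge> 0" "\<And>z. (LINT y|lborel. \<bar>levy_kernel \<psi> z y\<bar>) \<le> A * min ((norm z)\<^sup>2) 1"
proof -
  obtain R where R: "R > 0" "\<And>x. norm x > R \<Longrightarrow> \<psi> x = 0"
    using assms unfolding test_function_iff_bounded by blast
  obtain B where B: "B \<ge> 0" "\<And>v x. \<bar>dirderiv v (dirderiv v \<psi>) x\<bar> \<le> B * (norm v)\<^sup>2"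
    using dirderiv2_bounded[OF assms] by blast
  define A where "A = B * measure lborel (cball (0::real^'d) (R + 1)) + 2 * (LINT y|lborel. \<bar>\<psi> y\<bar>)"
  have A: "B * measure lborel (cball (0::real^'d) (R + 1)) \<le> A" "2 * (LINT y|lborel. \<bar>\<psi> y\<bar>) \<le> A"
    unfolding A_def using B(1) by (auto intro!: integral_nonneg_AE)
  have A0: "A \<ge> 0" using A(2) by (rule order_trans[rotated]) (auto intro!: integral_nonneg_AE)
  show thesis
  proof (rule that[OF A0])
    fix z :: "real^'d"
    show "(LINT y|lborel. \<bar>levy_kernel \<psi> z y\<bar>) \<le> A * min ((norm z)\<^sup>2) 1"
    proof (cases "norm z \<le> 1")
      case True
      have bound: "\<bar>levy_kernel \<psi> z y\<bar> \<le> B * (norm z)\<^sup>2" for y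
        using taylor2[OF assms B(2), of y "- z"] True by (simp add: levy_kernel_def dirderiv_uminus)
      have "dirderiv z \<psi> y = 0" if "norm y > R" for y
      proof -
        have "(\<psi> has_derivative (\<lambda>v. 0)) (at y)"
        proof (rule has_derivative_transform_within_open[where f = "\<lambda>x. 0" and s = "{x. R < norm x}"])
          show "open {x::real^'d. R < norm x}"
            by (intro open_Collect_less continuous_intros)
        qed (use that R in auto)
        then have "partial i \<psi> y = 0" for i by (rule partial_eqI)
        then show ?thesis by (simp add: dirderiv_sum)
      qed
      then have "levy_kernel \<psi> z y = 0" if "norm y > R + 1" for y
        using that True R(2)[of y] R(2)[of "y - z"] norm_triangle_sub[of y z]
        by (simp add: levy_kernel_def)
      then have "(LINT y|lborel. \<bar>levy_kernel \<psi> z y\<bar>)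
          \<le> B * (norm z)\<^sup>2 * measure lborel (cball (0::real^'d) (R + 1))"
        by (intro test_function_abs_integral_le test_function_levy_kernel assms bound)
      also have "\<dots> \<le> A * (norm z)\<^sup>2"
        using mult_right_mono[OF A(1), of "(norm z)\<^sup>2"] by (simp add: mult_ac)
      also have "(norm z)\<^sup>2 = min ((norm z)\<^sup>2) 1" using True by (simp add: power_le_one)
      finally show ?thesis .
    next
      case False
      have i: "integrable lborel (\<lambda>y. \<bar>\<psi> (y - z)\<bar>)" "integrable lborel (\<lambda>y. \<bar>\<psi> y\<bar>)"
        using test_function_integrable[OF assms]
          test_function_integrable[OF test_function_shift[OF assms, of z]] by auto
      have "(LINT y|lborel. \<bar>levy_kernel \<psi> z y\<bar>) \<le> (LINT y|lborel. \<bar>\<psi> (y - z)\<bar> + \<bar>\<psi> y\<bar>)"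
        using False
        by (intro integral_mono integrable_abs Bochner_Integration.integrable_add i
            test_function_integrable test_function_levy_kernel assms) (auto simp: levy_kernel_def)
      also have "\<dots> = 2 * (LINT y|lborel. \<bar>\<psi> y\<bar>)"
        using lborel_integral_shift[of "\<lambda>y. \<bar>\<psi> y\<bar>" z] test_function_measurable[OF assms] i by simp
      also have "\<dots> \<le> A * min ((norm z)\<^sup>2) 1"
        using A(2) False by (simp add: min_absorb2 one_le_power)
      finally show ?thesis .
    qed
  qed
qed

section \<open>Smoothing a bounded Borel function by correlation\<close>

locale bounded_borel =
  fixes u :: "real^'d \<Rightarrow> real" and C :: real
  assumes u_measurable [measurable]: "u \<in> borel_measurable borel" and u_bounded: "\<And>x. \<bar>u x\<bar> \<le> C"
begin

text \<open>The convolution of \<open>u\<close> with the reflected test function, called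
  \<open>U\<close> above. It is smooth in \<open>x\<close> because translations and derivatives can
  be moved onto \<open>\<psi>\<close>.\<close>

definition corr :: "(real^'d \<Rightarrow> real) \<Rightarrow> real^'d \<Rightarrow> real" where
  "corr \<psi> x = (LINT y|lborel. u y * \<psi> (y - x))"

lemma C_nonneg: "C \<ge> 0"
  using u_bounded[of 0] by linarith

lemma integrable_u_times:
  assumes "integrable lborel \<psi>"
  shows "integrable lborel (\<lambda>y. u y * \<psi> y)"
proof (rule Bochner_Integration.integrable_bound)
  show "integrable lborel (\<lambda>y. C * \<bar>\<psi> y\<bar>)" using assms by simp
  show "AE y in lborel. norm (u y * \<psi> y) \<le> norm (C * \<bar>\<psi> y\<bar>)"
    using u_bounded C_nonneg by (intro AE_I2) (auto simp: abs_mult intro!: mult_right_mono)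
qed (use assms in measurable)

lemma corr_integrable: "test_function \<psi> \<Longrightarrow> integrable lborel (\<lambda>y. u y * \<psi> (y - x))"
  by (intro integrable_u_times test_function_integrable test_function_shift)

lemma corr_abs_le:
  assumes "test_function \<psi>"
  shows "\<bar>corr \<psi> x\<bar> \<le> C * (LINT y|lborel. \<bar>\<psi> y\<bar>)"
proof -
  have i: "integrable lborel (\<lambda>y. \<bar>\<psi> (y - x)\<bar>)"
    using test_function_integrable[OF test_function_shift[OF assms, of x]] by simp
  have "\<bar>corr \<psi> x\<bar> \<le> (LINT y|lborel. \<bar>u y * \<psi> (y - x)\<bar>)"
    unfolding corr_def by (rule integral_abs_bound)
  also have "\<dots> \<le> (LINT y|lborel. C * \<bar>\<psi> (y - x)\<bar>)"
    by (intro integral_mono integrable_abs corr_integrable assms integrable_mult_right i)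
       (auto simp: abs_mult intro!: mult_right_mono u_bounded)
  also have "\<dots> = C * (LINT y|lborel. \<bar>\<psi> y\<bar>)"
    using lborel_integral_shift[of "\<lambda>y. \<bar>\<psi> y\<bar>" x] test_function_measurable[OF assms] by simp
  finally show ?thesis .
qed

lemma corr_add:
  "test_function f \<Longrightarrow> test_function g \<Longrightarrow> corr (\<lambda>y. f y + g y) x = corr f x + corr g x"
  unfolding corr_def distrib_left by (intro Bochner_Integration.integral_add corr_integrable)

lemma corr_cmult: "corr (\<lambda>y. c * f y) x = c * corr f x"
  unfolding corr_def by (simp add: mult.left_commute[of _ c])

lemma corr_sum:
  assumes "\<And>i. i \<in> I \<Longrightarrow> test_function (f i)"
  shows "corr (\<lambda>y. \<Sum>i\<in>I. f i y) x = (\<Sum>i\<in>I. corr (f i) x)"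
  unfolding corr_def sum_distrib_left
  by (intro Bochner_Integration.integral_sum corr_integrable assms)

lemma corr_shift: "corr (\<lambda>y. \<psi> (y - a)) x = corr \<psi> (x + a)"
  by (simp add: corr_def diff_diff_eq)

text \<open>Exhibits linearity in \<open>v\<close>.\<close>

lemma corr_dirderiv:
  assumes "test_function \<psi>"
  shows "corr (dirderiv v \<psi>) x = v \<bullet> (\<chi> i. corr (partial i \<psi>) x)"
  unfolding dirderiv_sum[abs_def] inner_vec_def
  by (subst corr_sum) (auto simp: corr_cmult intro!: test_function_cmult test_function_partial assms)

lemma corr_levy_kernel:
  assumes "test_function \<psi>"
  shows "corr (levy_kernel \<psi> z) x = corr \<psi> (x + z) - corr \<psi> x
    + corr (dirderiv z \<psi>) x * indicator {z. norm z \<le> 1} z"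
proof -
  have "corr (levy_kernel \<psi> z) x
      = corr (\<lambda>y. (\<psi> (y - z) + (- 1) * \<psi> y) + indicator {z. norm z \<le> 1} z * dirderiv z \<psi> y) x"
    by (simp add: levy_kernel_def[abs_def] mult.commute)
  also have "\<dots> = (corr \<psi> (x + z) + (- 1) * corr \<psi> x)
      + indicator {z. norm z \<le> 1} z * corr (dirderiv z \<psi>) x"
    by (subst corr_add corr_cmult corr_shift;
        (intro test_function_add test_function_cmult test_function_shift test_function_dirderiv assms)?)+
       simp
  finally show ?thesis by simp
qed

text \<open>The expression is \<open>corr (levy_kernel \<psi> z) x\<close>, so the L1 bound of the
  kernel times the bound \<open>C\<close> of \<open>u\<close> suffices.\<close>

lemma corr_taylor:
  assumes "test_function \<psi>"
  shows "\<exists>A\<ge>0. \<forall>x z. norm z \<le> 1 \<longrightarrow> \<bar>corr \<psi> (x + z) - corr \<psi> x + corr (dirderiv z \<psi>) x\<bar> \<le> A * (norm z)\<^sup>2"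
proof -
  obtain A where A: "A \<ge> 0" "\<And>z. (LINT y|lborel. \<bar>levy_kernel \<psi> z y\<bar>) \<le> A * min ((norm z)\<^sup>2) 1"
    using levy_kernel_L1[OF assms] by blast
  show ?thesis
  proof (intro exI[of _ "C * A"] conjI allI impI)
    show "C * A \<ge> 0" using A C_nonneg by simp
    fix x z :: "real^'d" assume z: "norm z \<le> 1"
    have "\<bar>corr (levy_kernel \<psi> z) x\<bar> \<le> C * (LINT y|lborel. \<bar>levy_kernel \<psi> z y\<bar>)"
      by (intro corr_abs_le test_function_levy_kernel assms)
    also have "\<dots> \<le> C * (A * min ((norm z)\<^sup>2) 1)" by (intro mult_left_mono A C_nonneg)
    also have "min ((norm z)\<^sup>2) 1 = (norm z)\<^sup>2" using z by (simp add: power_le_one)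
    finally show "\<bar>corr \<psi> (x + z) - corr \<psi> x + corr (dirderiv z \<psi>) x\<bar> \<le> C * A * (norm z)\<^sup>2"
      using z by (simp add: corr_levy_kernel[OF assms])
  qed
qed

text \<open>Comes from the quadratic estimate rather than from differentiation under the integral
  sign.\<close>

lemma corr_has_derivative:
  assumes "test_function \<psi>"
  shows "(corr \<psi> has_derivative (\<lambda>v. - corr (dirderiv v \<psi>) x)) (at x)"
proof -
  obtain A where "A \<ge> 0" and A: "\<And>x z. norm z \<le> 1 \<Longrightarrow>
      \<bar>corr \<psi> (x + z) - corr \<psi> x + corr (dirderiv z \<psi>) x\<bar> \<le> A * (norm z)\<^sup>2"
    using corr_taylor[OF assms] by metis
  have "bounded_linear (\<lambda>v. - corr (dirderiv v \<psi>) x)"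
    unfolding corr_dirderiv[OF assms] by (intro bounded_linear_minus bounded_linear_inner_left)
  then show ?thesis by (rule has_derivative_quadratic[where B = A]) (simp add: A)
qed

lemma corr_dirderiv_bound:
  assumes "test_function \<psi>"
  obtains B where "B \<ge> 0" "\<And>v x. \<bar>corr (dirderiv v \<psi>) x\<bar> \<le> B * norm v"
proof
  let ?B = "\<Sum>i\<in>UNIV. C * (LINT y|lborel. \<bar>partial i \<psi> y\<bar>)"
  show "?B \<ge> 0" by (intro sum_nonneg mult_nonneg_nonneg C_nonneg integral_nonneg_AE) auto
  fix v x
  have "\<bar>corr (dirderiv v \<psi>) x\<bar> = norm (v \<bullet> (\<chi> i. corr (partial i \<psi>) x))"
    by (simp add: corr_dirderiv[OF assms])
  also have "\<dots> \<le> norm v * norm (\<chi> i. corr (partial i \<psi>) x)" by (simp add: Cauchy_Schwarz_ineq2)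
  also have "norm (\<chi> i. corr (partial i \<psi>) x) \<le> ?B"
    by (rule order_trans[OF norm_le_l1_cart])
       (auto intro!: sum_mono corr_abs_le test_function_partial assms)
  finally show "\<bar>corr (dirderiv v \<psi>) x\<bar> \<le> ?B * norm v" by (simp add: mult.commute mult_right_mono)
qed

lemma corr_dirderiv2_bound:
  fixes \<psi> :: "real^'d \<Rightarrow> real"
  assumes "test_function \<psi>"
  obtains B where "B \<ge> 0" "\<And>v x. \<bar>corr (dirderiv v (dirderiv v \<psi>)) x\<bar> \<le> B * (norm v)\<^sup>2"
proof
  let ?B = "\<Sum>i\<in>UNIV. \<Sum>j\<in>UNIV. C * (LINT y|lborel. \<bar>partial j (partial i \<psi>) y\<bar>)"
  have nn: "0 \<le> C * (LINT y|lborel. \<bar>partial j (partial i \<psi>) y\<bar>)" for i j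
    by (intro mult_nonneg_nonneg C_nonneg integral_nonneg_AE) auto
  show "?B \<ge> 0" by (intro sum_nonneg nn)
  fix v x :: "real^'d"
  have "corr (dirderiv v (dirderiv v \<psi>)) x
      = corr (\<lambda>y. \<Sum>i\<in>UNIV. \<Sum>j\<in>UNIV. v $ i * v $ j * partial j (partial i \<psi>) y) x"
    by (simp add: dirderiv2_sum[OF assms, abs_def])
  also have "\<dots> = (\<Sum>i\<in>UNIV. \<Sum>j\<in>UNIV. v $ i * v $ j * corr (partial j (partial i \<psi>)) x)"
    by (subst corr_sum; (intro sum.cong refl test_function_sum finite)?;
        (subst corr_sum)?)
       (auto simp: corr_cmult intro!: test_function_cmult test_function_partial assms)
  finally have "\<bar>corr (dirderiv v (dirderiv v \<psi>)) x\<bar>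
      \<le> (\<Sum>i\<in>UNIV. \<Sum>j\<in>UNIV. \<bar>v $ i * v $ j * corr (partial j (partial i \<psi>)) x\<bar>)"
    by (simp only:) (intro order_trans[OF sum_abs] sum_mono sum_abs)
  also have "\<dots> \<le> (\<Sum>i\<in>UNIV. \<Sum>j\<in>UNIV. (norm v * norm v) * (C * (LINT y|lborel. \<bar>partial j (partial i \<psi>) y\<bar>)))"
    unfolding abs_mult
    by (intro sum_mono mult_mono component_le_norm_cart corr_abs_le test_function_partial assms) auto
  finally show "\<bar>corr (dirderiv v (dirderiv v \<psi>)) x\<bar> \<le> ?B * (norm v)\<^sup>2"
    by (simp add: sum_distrib_left sum_distrib_right power2_eq_square mult.commute)
qed

text \<open>Since \<open>x\<close> enters as \<open>\<psi> (y - x)\<close>, each derivative moved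
  onto \<open>\<psi>\<close> changes the sign; in \<open>E_corr\<close> the two signs
  cancel.\<close>

abbreviation D_corr where "D_corr \<psi> \<equiv> (\<lambda>x v. - corr (dirderiv v \<psi>) x)"
abbreviation E_corr where "E_corr \<psi> \<equiv> (\<lambda>x v. corr (dirderiv v (dirderiv v \<psi>)) x)"

text \<open>Admits every correlation to the maximum principle, however irregular \<open>u\<close>
  is. The constant is the sum of the four separate bounds.\<close>

lemma corr_C2_bounded:
  assumes "test_function \<psi>"
  obtains B where "C2_bounded (corr \<psi>) (D_corr \<psi>) (E_corr \<psi>) B"
proof -
  obtain B1 where B1: "B1 \<ge> 0" "\<And>v x. \<bar>corr (dirderiv v \<psi>) x\<bar> \<le> B1 * norm v"
    using corr_dirderiv_bound[OF assms] by blast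
  obtain B2 where B2: "B2 \<ge> 0" "\<And>v x. \<bar>corr (dirderiv v (dirderiv v \<psi>)) x\<bar> \<le> B2 * (norm v)\<^sup>2"
    using corr_dirderiv2_bound[OF assms] by blast
  obtain A where A: "A \<ge> 0"
    "\<And>x z. norm z \<le> 1 \<Longrightarrow> \<bar>corr \<psi> (x + z) - corr \<psi> x + corr (dirderiv z \<psi>) x\<bar> \<le> A * (norm z)\<^sup>2"
    using corr_taylor[OF assms] by metis
  define B0 where "B0 = C * (LINT y|lborel. \<bar>\<psi> y\<bar>)"
  have B0: "B0 \<ge> 0" "\<And>x. \<bar>corr \<psi> x\<bar> \<le> B0"
    using corr_abs_le[OF assms] C_nonneg by (auto simp: B0_def intro!: mult_nonneg_nonneg integral_nonneg_AE)
  define B where "B = B0 + B1 + B2 + A"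
  have B: "B0 \<le> B" "B1 \<le> B" "B2 \<le> B" "A \<le> B" using B0 B1 B2 A by (auto simp: B_def)
  have *: "a \<le> B * r" if "a \<le> c * r" "c \<le> B" "r \<ge> 0" for a c r
    using that mult_right_mono order_trans by blast
  have "C2_bounded (corr \<psi>) (D_corr \<psi>) (E_corr \<psi>) B"
    unfolding C2_bounded_def
  proof (intro conjI allI impI)
    show "\<bar>corr \<psi> x\<bar> \<le> B" for x using B0(2)[of x] B(1) by linarith
    show "linear (D_corr \<psi> x)" for x
      using has_derivative_linear[OF corr_has_derivative[OF assms]] .
    show "\<bar>- corr (dirderiv v \<psi>) x\<bar> \<le> B * norm v" for x v
      using *[OF B1(2) B(2)] by simp
    show "\<bar>E_corr \<psi> x v\<bar> \<le> B * (norm v)\<^sup>2" for x v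
      using *[OF B2(2) B(3)] by simp
    show "\<bar>corr \<psi> (x + z) - corr \<psi> x - D_corr \<psi> x z\<bar> \<le> B * (norm z)\<^sup>2" if "norm z \<le> 1" for x z
      using *[OF A(2)[OF that] B(4)] by simp
    show "((\<lambda>t. D_corr \<psi> (x + t *\<^sub>R v) v) has_real_derivative E_corr \<psi> x v) (at 0)" for x v
    proof -
      note dd = test_function_dirderiv[OF assms, of v]
      have "((\<lambda>t. corr (dirderiv v \<psi>) (x + t *\<^sub>R v)) has_derivative
          (\<lambda>s. - corr (dirderiv (s *\<^sub>R v) (dirderiv v \<psi>)) (x + 0 *\<^sub>R v))) (at 0)"
        by (rule diff_chain_at[unfolded comp_def, where f = "\<lambda>t. x + t *\<^sub>R v" and g = "corr (dirderiv v \<psi>)"])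
           (auto intro!: derivative_eq_intros corr_has_derivative[OF dd])
      then have "((\<lambda>t. corr (dirderiv v \<psi>) (x + t *\<^sub>R v)) has_real_derivative - E_corr \<psi> x v) (at 0)"
        unfolding has_field_derivative_def
        by (rule has_derivative_eq_rhs) (auto simp: corr_dirderiv[OF dd] fun_eq_iff)
      then show ?thesis by (auto intro: derivative_eq_intros)
    qed
  qed
  then show thesis by (rule that)
qed

end

section \<open>The distribution as a generator\<close>

text \<open>Expanding the trace and exchanging sums leaves one quadratic form of the Hessian for
  each column.\<close>

lemma local_op_dirderiv:
  fixes \<sigma> :: "real^'p^'d"
  assumes "test_function \<psi>"
  shows "local_op \<sigma> b \<psi> x = (\<Sum>j\<in>UNIV. dirderiv (column j \<sigma>) (dirderiv (column j \<sigma>) \<psi>) x) + dirderiv b \<psi> x"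
proof -
  have "trace (\<sigma> ** transpose \<sigma> ** hessian \<psi> x)
      = (\<Sum>i\<in>UNIV. \<Sum>k\<in>UNIV. (\<Sum>j\<in>UNIV. \<sigma>$i$j * \<sigma>$k$j) * partial k (partial i \<psi>) x)"
    by (simp add: trace_def matrix_matrix_mult_def transpose_def hessian_def)
  also have "\<dots> = (\<Sum>i\<in>UNIV. \<Sum>k\<in>UNIV. \<Sum>j\<in>UNIV. \<sigma>$i$j * \<sigma>$k$j * partial k (partial i \<psi>) x)"
    by (simp add: sum_distrib_right)
  also have "\<dots> = (\<Sum>i\<in>UNIV. \<Sum>j\<in>UNIV. \<Sum>k\<in>UNIV. \<sigma>$i$j * \<sigma>$k$j * partial k (partial i \<psi>) x)"
    by (intro sum.cong refl sum.swap)
  also have "\<dots> = (\<Sum>j\<in>UNIV. \<Sum>i\<in>UNIV. \<Sum>k\<in>UNIV. \<sigma>$i$j * \<sigma>$k$j * partial k (partial i \<psi>) x)"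
    by (rule sum.swap)
  finally show ?thesis
    unfolding local_op_def dirderiv2_sum[OF assms] by (simp add: column_def dirderiv_def)
qed

context levy_generator
begin

lemma mu_id_measurable: "(\<lambda>z. z) \<in> borel_measurable \<mu>"
  by (rule borel_measurable_mu) simp

text \<open>Required for Fubini: \<open>\<mu>\<close> may have infinite mass near 0, but the
  complements of the balls of radius 1/(n+1) exhaust the punctured space and have finite
  measure.\<close>

lemma sigma_finite_mu: "sigma_finite_measure \<mu>"
proof
  define A where "A n = {z::'a. norm z \<ge> 1 / real (Suc n)}" for n
  have sets: "A n \<in> sets \<mu>" for n
  proof -
    have "A n \<in> sets borel" unfolding A_def by measurable
    moreover have "A n \<subseteq> - {0}" by (auto simp: A_def)
    ultimately show ?thesis unfolding sets_mu by (auto simp: sets_restrict_space_iff)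
  qed
  show "\<exists>A. countable A \<and> A \<subseteq> sets \<mu> \<and> \<Union> A = space \<mu> \<and> (\<forall>a\<in>A. emeasure \<mu> a \<noteq> \<infinity>)"
  proof (intro exI[of _ "range A"] conjI ballI)
    show "\<Union> (range A) = space \<mu>"
    proof -
      have "\<exists>n. 1 / real (Suc n) \<le> norm z" if "z \<noteq> 0" for z :: 'a
        using nat_approx_posE[of "norm z"] that by (metis less_imp_le zero_less_norm_iff)
      then show ?thesis by (auto simp: A_def space_mu)
    qed
    fix a assume "a \<in> range A"
    then obtain n where a: "a = A n" by auto
    have "emeasure \<mu> (A n) < \<infinity>"
      by (rule emeasure_finite_away[of "1 / real (Suc n)"]) (auto simp: sets, auto simp: A_def)
    then show "emeasure \<mu> a \<noteq> \<infinity>" by (simp add: a)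
  qed (use sets in auto)
qed

end

lemma dirderiv_measurable:
  fixes \<psi> :: "real^'d \<Rightarrow> real"
  assumes "test_function \<psi>" "f \<in> borel_measurable M" "g \<in> borel_measurable M"
  shows "(\<lambda>p. dirderiv (f p) \<psi> (g p)) \<in> borel_measurable M"
  unfolding dirderiv_sum
proof (intro borel_measurable_sum borel_measurable_times)
  fix i
  show "(\<lambda>p. f p $ i) \<in> borel_measurable M"
    unfolding cart_eq_inner_axis by (intro borel_measurable_inner assms(2) borel_measurable_const)
  show "(\<lambda>p. partial i \<psi> (g p)) \<in> borel_measurable M"
    using measurable_compose[OF assms(3) test_function_measurable[OF test_function_partial[OF assms(1)]]] .
qed

lemma levy_kernel_measurable:
  fixes \<psi> :: "real^'d \<Rightarrow> real"
  assumes "test_function \<psi>" and [measurable]: "f \<in> borel_measurable M" "g \<in> borel_measurable M"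
  shows "(\<lambda>p. levy_kernel \<psi> (f p) (g p)) \<in> borel_measurable M"
proof -
  note [measurable] = test_function_measurable[OF assms(1)] dirderiv_measurable[OF assms]
  have "(\<lambda>p. indicator {z. norm z \<le> 1} (f p) :: real) = (\<lambda>p. if norm (f p) \<le> 1 then 1 else 0)"
    by (auto simp: indicator_def)
  then have [measurable]: "(\<lambda>p. indicator {z. norm z \<le> 1} (f p) :: real) \<in> borel_measurable M"
    by (simp only:) measurable
  show ?thesis unfolding levy_kernel_def by measurable
qed

locale liouville = levy_generator \<mu> "\<lambda>j. column j \<sigma>" b + bounded_borel u C
  for \<mu> :: "(real^'d) measure" and \<sigma> :: "real^'p^'d" and b :: "real^'d" and u :: "real^'d \<Rightarrow> real" and C
begin

text \<open>The kernel is kept whole, since its single terms need not be integrable near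
  \<open>z = 0\<close>. Its L1 norm in \<open>y\<close> is bounded by the weight, which is
  integrable in \<open>z\<close>.\<close>

lemma integrable_u_levy_kernel:
  assumes "test_function \<psi>"
  shows "integrable (\<mu> \<Otimes>\<^sub>M lborel) (\<lambda>(z, y). u y * levy_kernel \<psi> z y)"
proof -
  interpret mu: sigma_finite_measure \<mu> by (rule sigma_finite_mu)
  interpret pair_sigma_finite \<mu> "lborel :: (real^'d) measure" ..
  have [measurable]: "fst \<in> borel_measurable (\<mu> \<Otimes>\<^sub>M lborel)"
    using measurable_compose[OF measurable_fst[of \<mu> lborel] mu_id_measurable] by simp
  have [measurable]: "snd \<in> borel_measurable (\<mu> \<Otimes>\<^sub>M lborel)"
    using measurable_compose[OF measurable_snd, of "\<lambda>z. z" lborel borel \<mu>] by simp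
  have m [measurable]: "(\<lambda>p. levy_kernel \<psi> (fst p) (snd p)) \<in> borel_measurable (\<mu> \<Otimes>\<^sub>M lborel)"
    by (rule levy_kernel_measurable[OF assms]) measurable
  have int: "integrable lborel (\<lambda>y. u y * levy_kernel \<psi> z y)" for z
    by (intro integrable_u_times test_function_integrable test_function_levy_kernel assms)
  obtain A where A: "A \<ge> 0" "\<And>z. (LINT y|lborel. \<bar>levy_kernel \<psi> z y\<bar>) \<le> A * min ((norm z)\<^sup>2) 1"
    using levy_kernel_L1[OF assms] by metis
  have "integrable (\<mu> \<Otimes>\<^sub>M lborel) (\<lambda>p. u (snd p) * levy_kernel \<psi> (fst p) (snd p))"
  proof (rule Fubini_integrable)
    show m2: "(\<lambda>p. u (snd p) * levy_kernel \<psi> (fst p) (snd p)) \<in> borel_measurable (\<mu> \<Otimes>\<^sub>M lborel)"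
      by measurable
    have le: "(LINT y|lborel. \<bar>u y * levy_kernel \<psi> z y\<bar>) \<le> C * A * min ((norm z)\<^sup>2) 1" for z
    proof -
      have "(LINT y|lborel. \<bar>u y * levy_kernel \<psi> z y\<bar>) \<le> (LINT y|lborel. C * \<bar>levy_kernel \<psi> z y\<bar>)"
        by (intro integral_mono integrable_abs int integrable_mult_right test_function_integrable
            test_function_levy_kernel assms) (auto simp: abs_mult intro!: mult_right_mono u_bounded)
      also have "\<dots> \<le> C * (A * min ((norm z)\<^sup>2) 1)"
        using A(2)[of z] C_nonneg by (simp add: mult_left_mono)
      finally show ?thesis by simp
    qed
    show "integrable \<mu> (\<lambda>z. LINT y|lborel. norm (u (snd (z, y)) * levy_kernel \<psi> (fst (z, y)) (snd (z, y))))"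
    proof (rule Bochner_Integration.integrable_bound)
      show "integrable \<mu> (\<lambda>z. C * A * min ((norm z)\<^sup>2) 1)" using integrable_min by simp
      show "(\<lambda>z. LINT y|lborel. norm (u (snd (z, y)) * levy_kernel \<psi> (fst (z, y)) (snd (z, y)))) \<in> borel_measurable \<mu>"
        by (intro lborel.borel_measurable_lebesgue_integral) (use m2 in \<open>simp add: case_prod_beta\<close>)
      show "AE z in \<mu>. norm (LINT y|lborel. norm (u (snd (z, y)) * levy_kernel \<psi> (fst (z, y)) (snd (z, y))))
          \<le> norm (C * A * min ((norm z)\<^sup>2) 1)"
      proof (rule AE_I2)
        fix z
        have "0 \<le> (LINT y|lborel. \<bar>u y * levy_kernel \<psi> z y\<bar>)" by (intro integral_nonneg_AE) auto
        then show "norm (LINT y|lborel. norm (u (snd (z, y)) * levy_kernel \<psi> (fst (z, y)) (snd (z, y))))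
            \<le> norm (C * A * min ((norm z)\<^sup>2) 1)"
          using order_trans[OF le[of z] abs_ge_self] by simp
      qed
    qed
  qed (use int in simp)
  then show ?thesis by (simp add: case_prod_unfold)
qed

text \<open>The substitution of \<open>- z\<close> for \<open>z\<close> undoes the reflection of the
  measure and turns the Levy integrand into \<open>levy_kernel\<close>.\<close>

lemma adjoint_op_eq:
  assumes "test_function \<psi>"
  shows "adjoint_op \<sigma> b \<mu> \<psi> y
    = (\<Sum>j\<in>UNIV. dirderiv (column j \<sigma>) (dirderiv (column j \<sigma>) \<psi>) y) - dirderiv b \<psi> y
      + (LINT z|\<mu>. levy_kernel \<psi> z y)"
proof -
  \<comment> \<open>\<open>reflected_measure\<close> is a \<open>distr\<close> into
    \<open>\<mu>\<close> itself, so \<open>uminus\<close> has to be measurable on the punctured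
    space.\<close>
  have uminus: "uminus \<in> measurable \<mu> \<mu>"
  proof -
    have "uminus \<in> measurable \<mu> (restrict_space borel (- {0::real^'d}))"
      by (rule measurable_restrict_space2) (auto simp: space_mu intro!: borel_measurable_mu)
    then show ?thesis using measurable_cong_sets[OF refl sets_mu] by blast
  qed
  have "(\<lambda>z. levy_kernel \<psi> (- z) y) \<in> borel_measurable \<mu>"
    by (intro levy_kernel_measurable assms borel_measurable_uminus mu_id_measurable) simp
  then have m: "(\<lambda>z. \<psi> (y + z) - \<psi> y - (z \<bullet> grad \<psi> y) * indicator {z. norm z \<le> 1} z) \<in> borel_measurable \<mu>"
    by (simp add: levy_kernel_def dirderiv_def indicator_def)
  have "nonlocal_op (reflected_measure \<mu>) \<psi> y
      = (LINT z|\<mu>. \<psi> (y + - z) - \<psi> y - (- z \<bullet> grad \<psi> y) * indicator {z. norm z \<le> 1} (- z))"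
    unfolding nonlocal_op_def reflected_measure_def by (rule integral_distr[OF uminus m])
  also have "\<dots> = (LINT z|\<mu>. levy_kernel \<psi> z y)"
    by (intro Bochner_Integration.integral_cong) (auto simp: levy_kernel_def dirderiv_def indicator_def)
  finally show ?thesis
    by (simp add: adjoint_op_def levy_op_def local_op_dirderiv[OF assms] dirderiv_uminus)
qed

lemma adjoint_op_measurable:
  assumes "test_function \<psi>"
  shows "adjoint_op \<sigma> b \<mu> \<psi> \<in> borel_measurable borel"
proof -
  interpret mu: sigma_finite_measure \<mu> by (rule sigma_finite_mu)
  have [measurable]: "snd \<in> borel_measurable (borel \<Otimes>\<^sub>M \<mu>)"
    using measurable_compose[OF measurable_snd[of borel \<mu>] mu_id_measurable] by simp
  have "(\<lambda>p. levy_kernel \<psi> (snd p) (fst p)) \<in> borel_measurable (borel \<Otimes>\<^sub>M \<mu>)"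
    by (rule levy_kernel_measurable[OF assms]) measurable
  then have [measurable]: "(\<lambda>y. LINT z|\<mu>. levy_kernel \<psi> z y) \<in> borel_measurable borel"
    by (intro mu.borel_measurable_lebesgue_integral) (simp add: case_prod_beta)
  have [measurable]: "dirderiv v \<psi> \<in> borel_measurable borel"
      "dirderiv v (dirderiv v \<psi>) \<in> borel_measurable borel" for v
    by (intro test_function_measurable test_function_dirderiv assms)+
  show ?thesis unfolding adjoint_op_eq[OF assms, abs_def] by measurable
qed

text \<open>Fubini exchanges the integrals over \<open>y\<close> and \<open>z\<close>: the adjoint
  acting on \<open>\<psi>\<close> becomes the generator acting on the correlation, evaluated at
  0.\<close>

lemma integral_u_adjoint_op:
  assumes "test_function \<psi>"
  shows "(LINT y|lborel. u y * adjoint_op \<sigma> b \<mu> \<psi> y) = gen (corr \<psi>) (D_corr \<psi>) (E_corr \<psi>) 0"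
proof -
  interpret mu: sigma_finite_measure \<mu> by (rule sigma_finite_mu)
  interpret pair_sigma_finite \<mu> "lborel :: (real^'d) measure" ..
  note F = integrable_u_levy_kernel[OF assms]
  define L where "L y = (\<Sum>j\<in>UNIV. dirderiv (column j \<sigma>) (dirderiv (column j \<sigma>) \<psi>) y) + (- 1) * dirderiv b \<psi> y" for y
  have L: "test_function L"
    unfolding L_def by (intro test_function_add test_function_sum test_function_cmult test_function_dirderiv assms) simp
  have "(LINT y|lborel. u y * adjoint_op \<sigma> b \<mu> \<psi> y)
      = (LINT y|lborel. u y * L y + (LINT z|\<mu>. u y * levy_kernel \<psi> z y))"
    by (simp add: adjoint_op_eq[OF assms] L_def distrib_left)
  also have "\<dots> = (LINT y|lborel. u y * L y) + (LINT y|lborel. (LINT z|\<mu>. u y * levy_kernel \<psi> z y))"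
    by (intro Bochner_Integration.integral_add integrable_u_times test_function_integrable L integrable_snd[OF F])
  also have "(LINT y|lborel. (LINT z|\<mu>. u y * levy_kernel \<psi> z y)) = (LINT z|\<mu>. (LINT y|lborel. u y * levy_kernel \<psi> z y))"
    by (rule Fubini_integral[OF F])
  also have "\<dots> = (LINT z|\<mu>. corr (levy_kernel \<psi> z) 0)"
    by (simp add: corr_def)
  also have "\<dots> = (LINT z|\<mu>. increment (corr \<psi>) (D_corr \<psi>) 0 z)"
    by (simp add: corr_levy_kernel[OF assms])
  also have "(LINT y|lborel. u y * L y) = corr L 0"
    by (simp add: corr_def)
  also have "corr L 0 = (\<Sum>j\<in>UNIV. E_corr \<psi> 0 (column j \<sigma>)) + D_corr \<psi> 0 b"
  proof -
    have "corr L 0 = corr (\<lambda>y. \<Sum>j\<in>UNIV. dirderiv (column j \<sigma>) (dirderiv (column j \<sigma>) \<psi>) y) 0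
        + corr (\<lambda>y. (- 1) * dirderiv b \<psi> y) 0"
      unfolding L_def[abs_def]
      by (intro corr_add test_function_sum test_function_cmult test_function_dirderiv assms) simp
    also have "\<dots> = (\<Sum>j\<in>UNIV. E_corr \<psi> 0 (column j \<sigma>)) + (- 1) * corr (dirderiv b \<psi>) 0"
      by (intro arg_cong2[where f = "(+)"] corr_cmult corr_sum test_function_dirderiv assms)
    finally show ?thesis by simp
  qed
  finally show ?thesis by (simp add: gen_def)
qed

text \<open>By translation invariance, testing with shifts of \<open>\<psi>\<close> reaches every
  point, not only 0.\<close>

lemma gen_corr_shift:
  assumes "test_function \<psi>"
  shows "gen (corr \<psi>) (D_corr \<psi>) (E_corr \<psi>) x
    = (LINT y|lborel. u y * adjoint_op \<sigma> b \<mu> (\<lambda>y. \<psi> (y - x)) y)"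
proof -
  note s = test_function_shift[OF assms, of x]
  have d: "dirderiv v (\<lambda>y. \<psi> (y - x)) = (\<lambda>y. dirderiv v \<psi> (y - x))" for v
    using dirderiv_shift[OF assms] by auto
  have dd: "dirderiv v (\<lambda>y. dirderiv v \<psi> (y - x)) = (\<lambda>y. dirderiv v (dirderiv v \<psi>) (y - x))" for v
    using dirderiv_shift[OF test_function_dirderiv[OF assms]] by auto
  show ?thesis
    unfolding integral_u_adjoint_op[OF s] gen_def d dd corr_shift by (simp add: add.commute)
qed

end

section \<open>Periods\<close>

text \<open>A sequence in \<open>G - V\<close> tending to \<open>0\<close>, projected to \<open>V\<close>'s orthogonal complement and
  normalised, accumulates at a unit vector all of whose multiples are limits of elements of \<open>G\<close>.\<close>

lemma closed_subgroup_gap: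
  fixes G :: "'a::euclidean_space set"
  assumes "closed G" and zero: "0 \<in> G" and diff: "\<And>x y. x \<in> G \<Longrightarrow> y \<in> G \<Longrightarrow> x - y \<in> G"
  defines "V \<equiv> {g \<in> G. \<forall>t. t *\<^sub>R g \<in> G}"
  obtains r where "r > 0" "\<And>z. z \<in> G - V \<Longrightarrow> norm z \<ge> r"
proof -
  have minus: "- x \<in> G" if "x \<in> G" for x using diff[OF zero that] by simp
  have add: "x + y \<in> G" if "x \<in> G" "y \<in> G" for x y
    using diff[OF that(1) minus[OF that(2)]] by simp
  have nat: "real n *\<^sub>R x \<in> G" if "x \<in> G" for n x
    by (induction n) (auto simp: zero scaleR_add_left intro: add that)
  have int: "real_of_int k *\<^sub>R x \<in> G" if "x \<in> G" for k x
  proof (cases "k \<ge> 0")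
    case True
    then show ?thesis using nat[OF that, of "nat k"] by simp
  next
    case False
    then show ?thesis using minus[OF nat[OF that, of "nat (- k)"]] by simp
  qed
  have V: "subspace V"
    by (rule subspaceI) (auto simp: V_def zero scaleR_add_right intro: add)
  have "\<exists>r>0. \<forall>z\<in>G - V. norm z \<ge> r"
  proof (rule ccontr)
    assume neg: "\<not> (\<exists>r>0. \<forall>z\<in>G - V. norm z \<ge> r)"
    have "\<exists>p. p \<in> G \<and> p \<noteq> 0 \<and> norm p < 1 / real (Suc n) \<and> (\<forall>w\<in>V. p \<bullet> w = 0)" for n
    proof -
      have "1 / real (Suc n) > 0" by simp
      then obtain z where z: "z \<in> G" "z \<notin> V" "norm z < 1 / real (Suc n)"
        using neg by (metis Diff_iff not_le)
      obtain y p where yp: "y \<in> span V" "\<And>w. w \<in> span V \<Longrightarrow> orthogonal p w" "z = y + p"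
        using orthogonal_subspace_decomp_exists[of V z] by metis
      have y: "y \<in> V" using yp(1) V span_eq_iff by blast
      have orth: "p \<bullet> w = 0" if "w \<in> V" for w
        using yp(2)[OF span_base[OF that]] by (simp add: orthogonal_def)
      have "(norm z)\<^sup>2 = (norm y)\<^sup>2 + (norm p)\<^sup>2"
        unfolding yp(3) using orth[OF y]
        by (metis inner_commute norm_add_Pythagorean orthogonal_def)
      then have "norm p \<le> norm z"
        by (intro power2_le_imp_le[OF _ norm_ge_zero]) simp
      \<comment> \<open>Removing the component \<open>y\<close> in \<open>V\<close>, a subset of
        \<open>G\<close>, keeps \<open>p\<close> in \<open>G\<close>; as \<open>z\<close> is outside
        \<open>V\<close>, \<open>p\<close> is nonzero.\<close>
      moreover have "p \<in> G" using diff[OF z(1), of y] y yp(3) by (simp add: V_def)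
      moreover have "p \<noteq> 0" using z(2) y yp(3) by auto
      ultimately show ?thesis using orth z(3) by (intro exI[of _ p]) auto
    qed
    then obtain p where p: "\<And>n. p n \<in> G" "\<And>n. p n \<noteq> 0" "\<And>n. norm (p n) < 1 / real (Suc n)"
        "\<And>n w. w \<in> V \<Longrightarrow> p n \<bullet> w = 0"
      by metis
    define e where "e n = p n /\<^sub>R norm (p n)" for n
    have "\<forall>n. e n \<in> sphere 0 1" using p(2) by (simp add: e_def)
    then obtain l s where l: "l \<in> sphere 0 1" "strict_mono s" "(e \<circ> s) \<longlonglongrightarrow> l"
      using compact_sphere[of "0::'a" 1] unfolding compact_def by blast
    have p0: "(\<lambda>n. norm (p (s n))) \<longlonglongrightarrow> 0"
    proof -
      have "(\<lambda>n. norm (p n)) \<longlonglongrightarrow> 0"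
      proof (rule Lim_null_comparison)
        show "\<forall>\<^sub>F n in sequentially. norm (norm (p n)) \<le> 1 / real (Suc n)"
          using p(3) by (intro always_eventually) (simp add: less_imp_le)
        show "(\<lambda>n. 1 / real (Suc n)) \<longlonglongrightarrow> 0" by (rule LIMSEQ_Suc[OF lim_1_over_n])
      qed
      from LIMSEQ_subseq_LIMSEQ[OF this l(2)] show ?thesis by (simp add: comp_def)
    qed
    have tl: "t *\<^sub>R l \<in> G" for t
    proof -
      \<comment> \<open>Rounding down costs at most \<open>norm (p (s n))\<close>, which tends to 0,
        so integer multiples of \<open>p (s n)\<close> converge to
        \<open>t *\<^sub>R l\<close>.\<close>
      define k where "k n = \<lfloor>t / norm (p (s n))\<rfloor>" for n
      have "(\<lambda>n. real_of_int (k n) * norm (p (s n)) - t) \<longlonglongrightarrow> 0"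
      proof (rule Lim_null_comparison[OF _ p0], intro always_eventually allI)
        fix n
        have pos: "norm (p (s n)) > 0" using p(2) by simp
        have "real_of_int (k n) \<le> t / norm (p (s n))" "t / norm (p (s n)) < real_of_int (k n) + 1"
          unfolding k_def by linarith+
        then have "real_of_int (k n) * norm (p (s n)) \<le> t" "t < (real_of_int (k n) + 1) * norm (p (s n))"
          using pos by (simp_all add: pos_le_divide_eq pos_divide_less_eq)
        then show "norm (real_of_int (k n) * norm (p (s n)) - t) \<le> norm (p (s n))"
          by (simp add: distrib_right)
      qed
      then have "(\<lambda>n. real_of_int (k n) * norm (p (s n))) \<longlonglongrightarrow> t" by (rule LIM_zero_cancel)
      from tendsto_scaleR[OF this l(3)]
      have lim: "(\<lambda>n. (real_of_int (k n) * norm (p (s n))) *\<^sub>R e (s n)) \<longlonglongrightarrow> t *\<^sub>R l" by (simp add: comp_def)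
      have "(real_of_int (k n) * norm (p (s n))) *\<^sub>R e (s n) \<in> G" for n
        using int[OF p(1), of "k n" "s n"] p(2)[of "s n"] by (simp add: e_def mult.assoc)
      then show ?thesis by (rule closed_sequentially[OF assms(1) _ lim])
    qed
    \<comment> \<open>Every \<open>e (s n)\<close> is orthogonal to \<open>V\<close>, hence so is
      the limit \<open>l\<close>, which itself lies in \<open>V\<close> and has norm 1.\<close>
    have "l \<in> V" using tl tl[of 1] by (simp add: V_def)
    then have "e (s n) \<bullet> l = 0" for n using p(4) by (simp add: e_def)
    moreover have "(\<lambda>n. e (s n) \<bullet> l) \<longlonglongrightarrow> l \<bullet> l"
      using l(3) by (intro tendsto_inner tendsto_const) (simp add: comp_def)
    ultimately have "l \<bullet> l = 0" using LIMSEQ_unique by fastforce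
    then show False using l(1) by simp
  qed
  then show thesis using that by blast
qed

lemma group_closure_subset:
  assumes "S \<subseteq> P" "0 \<in> P" "\<And>x y. x \<in> P \<Longrightarrow> y \<in> P \<Longrightarrow> x - y \<in> P"
  shows "group_closure S \<subseteq> P"
proof
  fix x assume "x \<in> group_closure S"
  then show "x \<in> P" by induction (use assms in auto)
qed

lemma closure_group_closure_diff:
  fixes S :: "'a::real_normed_vector set"
  assumes "x \<in> closure (group_closure S)" "y \<in> closure (group_closure S)"
  shows "x - y \<in> closure (group_closure S)"
proof -
  obtain a where a: "\<And>n. a n \<in> group_closure S" "a \<longlonglongrightarrow> x"
    using assms(1) unfolding closure_sequential by blast
  obtain c where c: "\<And>n. c n \<in> group_closure S" "c \<longlonglongrightarrow> y"
    using assms(2) unfolding closure_sequential by blast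
  show ?thesis
    unfolding closure_sequential
    by (rule exI[of _ "\<lambda>n. a n - c n"]) (use a c in \<open>auto intro: group_closure.diff tendsto_diff\<close>)
qed

lemma zero_in_G_mu: "0 \<in> G_mu \<mu>"
  unfolding G_mu_def using closure_subset[of "group_closure (msupp \<mu>)"] by auto

lemma msupp_subset_G_mu: "msupp \<mu> \<subseteq> G_mu \<mu>"
  unfolding G_mu_def using closure_subset[of "group_closure (msupp \<mu>)"]
  by (auto intro: group_closure.base)

text \<open>An intersection of preimages of the closed set \<open>G_mu \<mu>\<close> under scalings.
  It makes the domain of integration in \<open>c_mu\<close> Borel.\<close>

lemma closed_V_mu: "closed (V_mu \<mu>)"
proof -
  have "V_mu \<mu> = G_mu \<mu> \<inter> (\<Inter>t. (\<lambda>g. t *\<^sub>R g) -` G_mu \<mu>)"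
    by (auto simp: V_mu_def)
  moreover have "closed (G_mu \<mu>)" by (simp add: G_mu_def)
  ultimately show ?thesis
    by (auto intro!: closed_Int closed_INT continuous_closed_vimage continuous_intros)
qed

section \<open>The closed group of periods\<close>

context bounded_borel
begin

text \<open>Comparison at the base point 0 is enough, because shifting \<open>\<psi>\<close> moves
  the base point.\<close>

definition periods :: "(real^'d) set" where
  "periods = {s. \<forall>\<psi>. test_function \<psi> \<longrightarrow> corr \<psi> s = corr \<psi> 0}"

lemma corr_period:
  assumes "s \<in> periods" "test_function \<psi>"
  shows "corr \<psi> (x + s) = corr \<psi> x"
  using assms test_function_shift[OF assms(2), of x] corr_shift[of \<psi> x s] corr_shift[of \<psi> x 0]
  by (auto simp: periods_def add.commute)

lemma zero_in_periods: "0 \<in> periods"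
  by (simp add: periods_def)

lemma periods_add: "x \<in> periods \<Longrightarrow> y \<in> periods \<Longrightarrow> x + y \<in> periods"
  using corr_period by (auto simp: periods_def)

lemma periods_diff: "x \<in> periods \<Longrightarrow> y \<in> periods \<Longrightarrow> x - y \<in> periods"
  using corr_period[of y _ "x - y"] by (auto simp: periods_def)

lemma closed_periods: "closed periods"
proof -
  have "closed {s. corr \<psi> s = corr \<psi> 0}" if "test_function \<psi>" for \<psi>
    using has_derivative_continuous[OF corr_has_derivative[OF that]]
    by (intro closed_Collect_eq continuous_on_const continuous_at_imp_continuous_on) auto
  then have "closed (\<Inter>\<psi>\<in>Collect test_function. {s. corr \<psi> s = corr \<psi> 0})" by auto
  also have "(\<Inter>\<psi>\<in>Collect test_function. {s. corr \<psi> s = corr \<psi> 0}) = periods"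
    by (auto simp: periods_def)
  finally show ?thesis .
qed

lemma corr_line_derivative:
  assumes "test_function \<psi>"
  shows "((\<lambda>t. corr \<psi> (x + t *\<^sub>R v)) has_real_derivative - corr (dirderiv v \<psi>) (x + t *\<^sub>R v)) (at t)"
proof -
  obtain B where "C2_bounded (corr \<psi>) (D_corr \<psi>) (E_corr \<psi>) B"
    using corr_C2_bounded[OF assms] .
  from C2_bounded_line_derivative[OF this] show ?thesis .
qed

text \<open>A correlation is constant on all lines parallel to \<open>v\<close> iff its derivative
  along \<open>v\<close> vanishes.\<close>

lemma line_subset_periods_iff:
  "(\<forall>t. t *\<^sub>R v \<in> periods) \<longleftrightarrow> (\<forall>\<psi> x. test_function \<psi> \<longrightarrow> corr (dirderiv v \<psi>) x = 0)"
proof safe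
  fix \<psi> :: "real^'d \<Rightarrow> real" and x assume P: "\<forall>t. t *\<^sub>R v \<in> periods" and \<psi>: "test_function \<psi>"
  have "(\<lambda>t. corr \<psi> (x + t *\<^sub>R v)) = (\<lambda>t. corr \<psi> x)"
    using corr_period[OF _ \<psi>] P by auto
  then have "((\<lambda>t. corr \<psi> x) has_real_derivative - corr (dirderiv v \<psi>) x) (at 0)"
    using corr_line_derivative[OF \<psi>, of x v 0] by simp
  from DERIV_unique[OF this DERIV_const] show "corr (dirderiv v \<psi>) x = 0" by simp
next
  fix t assume *: "\<forall>\<psi> x. test_function \<psi> \<longrightarrow> corr (dirderiv v \<psi>) x = 0"
  have "corr \<psi> (t *\<^sub>R v) = corr \<psi> 0" if "test_function \<psi>" for \<psi>
    using DERIV_isconst_all[of "\<lambda>t. corr \<psi> (0 + t *\<^sub>R v)" t 0]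
      corr_line_derivative[OF that, of 0 v] * that by simp
  then show "t *\<^sub>R v \<in> periods" by (simp add: periods_def)
qed

text \<open>\<open>periods\<close> is only a group, but the vectors all of whose multiples are
  periods form a subspace.\<close>

lemma span_subset_periods:
  assumes "\<And>v t. v \<in> S \<Longrightarrow> t *\<^sub>R v \<in> periods"
  shows "span S \<subseteq> periods"
proof -
  have "subspace {v. \<forall>t. t *\<^sub>R v \<in> periods}"
    by (rule subspaceI) (auto simp: zero_in_periods scaleR_add_right intro: periods_add)
  then have "span S \<subseteq> {v. \<forall>t. t *\<^sub>R v \<in> periods}"
    using assms by (intro span_minimal) auto
  moreover have "v \<in> periods" if "\<forall>t. t *\<^sub>R v \<in> periods" for v
    using that[rule_format, of 1] by simp
  ultimately show ?thesis by blast
qed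

end

section \<open>The drift correction and the two implications\<close>

context liouville
begin

text \<open>Each point off the support is the centre of a null ball; by the Lindelof property
  countably many null balls cover all such points.\<close>

lemma AE_in_msupp: "AE z in \<mu>. z \<in> msupp \<mu>"
proof -
  define F where "F = {ball z r |z r. r > 0 \<and> emeasure \<mu> (ball z r \<inter> space \<mu>) = 0}"
  have "\<And>S. S \<in> F \<Longrightarrow> open S" by (auto simp: F_def)
  then obtain F' where F': "F' \<subseteq> F" "countable F'" "\<Union>F' = \<Union>F" by (rule Lindelof)
  have null: "S \<inter> space \<mu> \<in> null_sets \<mu>" if mem: "S \<in> F'" for S
  proof -
    obtain z r where S: "S = ball z r" "emeasure \<mu> (ball z r \<inter> space \<mu>) = 0"
      using F'(1) mem unfolding F_def by blast
    have "S \<inter> space \<mu> \<in> sets \<mu>"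
      unfolding sets_mu space_mu S(1) by (auto simp: sets_restrict_space Int_commute)
    then show ?thesis using S by auto
  qed
  have "(\<Union>S\<in>F'. S \<inter> space \<mu>) \<in> null_sets \<mu>"
    by (rule null_sets_UN'[OF F'(2) null])
  moreover have "{z \<in> space \<mu>. z \<notin> msupp \<mu>} \<subseteq> (\<Union>S\<in>F'. S \<inter> space \<mu>)"
  proof
    fix z assume z: "z \<in> {z \<in> space \<mu>. z \<notin> msupp \<mu>}"
    then obtain r where "r > 0" "emeasure \<mu> (ball z r \<inter> space \<mu>) = 0"
      by (auto simp: msupp_def space_mu zero_less_iff_neq_zero)
    then have "z \<in> \<Union>F" unfolding F_def by force
    then show "z \<in> (\<Union>S\<in>F'. S \<inter> space \<mu>)" using z F'(3) by auto
  qed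
  ultimately show ?thesis by (rule AE_I')
qed

text \<open>Guarantees that the integral in \<open>c_mu\<close> is not the default value 0. Almost
  every point of the domain lies in \<open>G_mu \<mu> - V_mu \<mu>\<close>, hence at distance at
  least \<open>r\<close> from 0, where a multiple of the weight exceeds 1.\<close>

lemma integrable_c_mu:
  "integrable \<mu> (\<lambda>z. indicator ({z. norm z \<le> 1} - V_mu \<mu>) z *\<^sub>R z)"
proof -
  obtain r where r: "r > 0" "\<And>z. z \<in> G_mu \<mu> - V_mu \<mu> \<Longrightarrow> norm z \<ge> r"
    unfolding V_mu_def G_mu_def
    by (rule closed_subgroup_gap[of "closure (group_closure (msupp \<mu>))"])
       (use zero_in_G_mu[of \<mu>] closure_group_closure_diff in \<open>auto simp: G_mu_def\<close>)
  define c where "c = min (r\<^sup>2) 1"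
  have c: "c > 0" using r by (simp add: c_def)
  show ?thesis
  proof (rule Bochner_Integration.integrable_bound)
    show "integrable \<mu> (\<lambda>z. min ((norm z)\<^sup>2) 1 / c)" using integrable_min by simp
    have "{z. norm z \<le> 1} - V_mu \<mu> \<in> sets borel"
      using closed_V_mu by (intro sets.Diff borel_closed closed_Collect_le continuous_intros)
    then show "(\<lambda>z. indicator ({z. norm z \<le> 1} - V_mu \<mu>) z *\<^sub>R z) \<in> borel_measurable \<mu>"
      by (intro borel_measurable_mu borel_measurable_scaleR borel_measurable_indicator) auto
    show "AE z in \<mu>. norm (indicator ({z. norm z \<le> 1} - V_mu \<mu>) z *\<^sub>R z) \<le> norm (min ((norm z)\<^sup>2) 1 / c)"
      using AE_in_msupp
    proof eventually_elim
      case (elim z)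
      show ?case
      proof (cases "z \<in> {z. norm z \<le> 1} - V_mu \<mu>")
        case True
        then have "norm z \<ge> r" using r(2)[of z] elim msupp_subset_G_mu by auto
        then have "c \<le> min ((norm z)\<^sup>2) 1"
          unfolding c_def using power_mono[of r "norm z" 2] r(1) by (intro min.mono) auto
        then have "1 \<le> norm (min ((norm z)\<^sup>2) 1 / c)" using c by simp
        then show ?thesis using True by simp
      qed simp
    qed
  qed
qed

text \<open>For \<open>z\<close> in the support the difference \<open>corr \<psi> (x + z) - corr \<psi> x\<close> vanishes, and along \<open>V_mu\<close>
  so does the derivative: only the compensator outside \<open>V_mu\<close> is left.\<close>

lemma integral_increment_eq_drift:
  assumes "G_mu \<mu> \<subseteq> periods" and \<psi>: "test_function \<psi>"
  shows "(LINT z|\<mu>. increment (corr \<psi>) (D_corr \<psi>) x z) = D_corr \<psi> x (c_mu \<mu>)"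
proof -
  let ?A = "{z. norm z \<le> 1} - V_mu \<mu>"
  have bl: "bounded_linear (D_corr \<psi> x)"
    using corr_has_derivative[OF \<psi>] has_derivative_bounded_linear by blast
  have D: "D_corr \<psi> x z = 0" if "z \<in> V_mu \<mu>" for z
  proof -
    have "\<forall>t. t *\<^sub>R z \<in> periods" using that assms(1) by (auto simp: V_mu_def)
    then show ?thesis using \<psi> by (simp add: line_subset_periods_iff)
  qed
  have "(LINT z|\<mu>. increment (corr \<psi>) (D_corr \<psi>) x z) = (LINT z|\<mu>. - D_corr \<psi> x (indicator ?A z *\<^sub>R z))"
  proof (rule integral_cong_AE)
    obtain B where "C2_bounded (corr \<psi>) (D_corr \<psi>) (E_corr \<psi>) B"
      using corr_C2_bounded[OF \<psi>] .
    then show "increment (corr \<psi>) (D_corr \<psi>) x \<in> borel_measurable \<mu>"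
      by (intro borel_measurable_mu increment_measurable)
    have "D_corr \<psi> x \<in> borel_measurable borel"
      by (intro linear_borel_measurable bounded_linear.linear bl)
    then show "(\<lambda>z. - D_corr \<psi> x (indicator ?A z *\<^sub>R z)) \<in> borel_measurable \<mu>"
      using measurable_compose[OF borel_measurable_integrable[OF integrable_c_mu]] by simp
    show "AE z in \<mu>. increment (corr \<psi>) (D_corr \<psi>) x z = - D_corr \<psi> x (indicator ?A z *\<^sub>R z)"
      using AE_in_msupp
    proof eventually_elim
      case (elim z)
      then have "z \<in> periods" using assms(1) msupp_subset_G_mu by blast
      from corr_period[OF this \<psi>] have "corr \<psi> (x + z) = corr \<psi> x" .
      then show ?case
        using D[of z] linear_0[OF bounded_linear.linear[OF bl]]
        by (cases "z \<in> ?A") (auto simp: indicator_def)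
    qed
  qed
  also have "\<dots> = - D_corr \<psi> x (LINT z|\<mu>. indicator ?A z *\<^sub>R z)"
    using integral_bounded_linear[OF bl integrable_c_mu] by simp
  \<comment> \<open>The sign left by the compensator is absorbed by the minus in
    \<open>c_mu\<close>.\<close>
  also have "\<dots> = D_corr \<psi> x (c_mu \<mu>)"
    unfolding c_mu_def set_lebesgue_integral_def
    using linear_neg[OF bounded_linear.linear[OF bl]] by simp
  finally show ?thesis .
qed

text \<open>Once \<open>G_mu\<close>-periodicity is known, the operator acts as a local one with
  corrected drift. Both implications use this.\<close>

lemma gen_corr_eq_local:
  assumes "G_mu \<mu> \<subseteq> periods" and \<psi>: "test_function \<psi>"
  shows "gen (corr \<psi>) (D_corr \<psi>) (E_corr \<psi>) x
    = (\<Sum>j\<in>UNIV. E_corr \<psi> x (column j \<sigma>)) + D_corr \<psi> x (b + c_mu \<mu>)"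
proof -
  have lin: "D_corr \<psi> x (b + c_mu \<mu>) = D_corr \<psi> x b + D_corr \<psi> x (c_mu \<mu>)"
    using linear_add[OF has_derivative_linear[OF corr_has_derivative[OF \<psi>]]] .
  show ?thesis
    unfolding gen_def integral_increment_eq_drift[OF assms] lin by simp
qed

abbreviation period_group where
  "period_group \<equiv> closure {g + w | g w. g \<in> G_mu \<mu> \<and> w \<in> W_space \<sigma> (b + c_mu \<mu>)}"

text \<open>The order matters: columns and support come from the Bernstein method, closing up the
  support gives \<open>G_mu\<close>, and only then can the drift be read off the reduced
  equation.\<close>

lemma solution_imp_periodic:
  assumes sol: "\<And>\<psi>. test_function \<psi> \<Longrightarrow> (LINT y|lborel. u y * adjoint_op \<sigma> b \<mu> \<psi> y) = 0"
  shows "period_group \<subseteq> periods"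
proof -
  have gen0: "gen (corr \<psi>) (D_corr \<psi>) (E_corr \<psi>) x = 0" if "test_function \<psi>" for \<psi> x
    unfolding gen_corr_shift[OF that] by (intro sol test_function_shift that)
  have column: "corr (dirderiv (column j \<sigma>) \<psi>) x = 0" if \<psi>: "test_function \<psi>" for \<psi> j x
  proof -
    \<comment> \<open>The sign makes \<open>corr \<phi>\<close> the derivative of
      \<open>corr \<psi>\<close> along the column. As a correlation it is again annihilated by the
      generator.\<close>
    define \<phi> where "\<phi> = (\<lambda>y. (- 1) * dirderiv (column j \<sigma>) \<psi> y)"
    have \<phi>: "test_function \<phi>" unfolding \<phi>_def by (intro test_function_cmult test_function_dirderiv \<psi>)
    have eq: "corr \<phi> = (\<lambda>x. D_corr \<psi> x (column j \<sigma>))"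
      unfolding \<phi>_def corr_cmult by simp
    obtain B where B: "C2_bounded (corr \<psi>) (D_corr \<psi>) (E_corr \<psi>) B"
      using corr_C2_bounded[OF \<psi>] .
    obtain B' where B': "C2_bounded (corr \<phi>) (D_corr \<phi>) (E_corr \<phi>) B'"
      using corr_C2_bounded[OF \<phi>] .
    from diffusion_derivative_zero[OF B B'[unfolded eq] gen0[OF \<psi>] gen0[OF \<phi>, unfolded eq], of x]
    show ?thesis by simp
  qed
  have "msupp \<mu> \<subseteq> periods"
  proof
    fix h assume h: "h \<in> msupp \<mu>"
    have "corr \<psi> (0 + h) - corr \<psi> 0 = 0" if \<psi>: "test_function \<psi>" for \<psi>
    proof -
      define \<phi> where "\<phi> = (\<lambda>y. \<psi> (y - h) + (- 1) * \<psi> y)"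
      have \<phi>: "test_function \<phi>"
        unfolding \<phi>_def by (intro test_function_add test_function_shift test_function_cmult \<psi>)
      have eq: "corr \<phi> = (\<lambda>x. corr \<psi> (x + h) - corr \<psi> x)"
      proof
        fix x
        have "corr \<phi> x = corr (\<lambda>y. \<psi> (y - h)) x + corr (\<lambda>y. (- 1) * \<psi> y) x"
          unfolding \<phi>_def by (intro corr_add test_function_shift test_function_cmult \<psi>)
        then show "corr \<phi> x = corr \<psi> (x + h) - corr \<psi> x"
          unfolding corr_cmult corr_shift by simp
      qed
      obtain B where B: "C2_bounded (corr \<psi>) (D_corr \<psi>) (E_corr \<psi>) B"
        using corr_C2_bounded[OF \<psi>] .
      obtain B' where B': "C2_bounded (corr \<phi>) (D_corr \<phi>) (E_corr \<phi>) B'"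
        using corr_C2_bounded[OF \<phi>] .
      show ?thesis
        by (rule jump_increment_zero[OF B B'[unfolded eq] gen0[OF \<psi>] gen0[OF \<phi>, unfolded eq]])
           (use h in \<open>auto simp: msupp_def\<close>)
    qed
    then show "h \<in> periods" by (simp add: periods_def)
  qed
  then have G: "G_mu \<mu> \<subseteq> periods"
    unfolding G_mu_def
    by (intro closure_minimal closed_periods group_closure_subset zero_in_periods periods_diff)
  \<comment> \<open>The second-order terms are column derivatives of the test functions
    \<open>dirderiv (column j \<sigma>) \<psi>\<close>, so \<open>column\<close> removes
    them.\<close>
  have drift: "corr (dirderiv (b + c_mu \<mu>) \<psi>) x = 0" if "test_function \<psi>" for \<psi> x
    using gen0[OF that, of x] column[OF test_function_dirderiv[OF that]]
    unfolding gen_corr_eq_local[OF G that] by simp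
  have W: "W_space \<sigma> (b + c_mu \<mu>) \<subseteq> periods"
    unfolding W_space_def
  proof (rule span_subset_periods)
    fix v t assume "v \<in> columns \<sigma> \<union> {b + c_mu \<mu>}"
    then have "\<forall>\<psi> x. test_function \<psi> \<longrightarrow> corr (dirderiv v \<psi>) x = 0"
      using column drift by (auto simp: columns_def)
    then show "t *\<^sub>R v \<in> periods" using line_subset_periods_iff by blast
  qed
  have "{g + w | g w. g \<in> G_mu \<mu> \<and> w \<in> W_space \<sigma> (b + c_mu \<mu>)} \<subseteq> periods"
    using G W by (auto intro: periods_add)
  then show ?thesis by (rule closure_minimal[OF _ closed_periods])
qed

text \<open>Both \<open>G_mu\<close> and \<open>W_space\<close> contain 0, so each consists of
  periods. The local form of the generator then vanishes term by term.\<close>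

lemma periodic_imp_solution:
  assumes per: "period_group \<subseteq> periods" and \<psi>: "test_function \<psi>"
  shows "(LINT y|lborel. u y * adjoint_op \<sigma> b \<mu> \<psi> y) = 0"
proof -
  have sum: "g + w \<in> periods" if "g \<in> G_mu \<mu>" "w \<in> W_space \<sigma> (b + c_mu \<mu>)" for g w
    using that per closure_subset[of "{g + w | g w. g \<in> G_mu \<mu> \<and> w \<in> W_space \<sigma> (b + c_mu \<mu>)}"] by blast
  have G: "G_mu \<mu> \<subseteq> periods"
    using sum[of _ 0] by (auto simp: W_space_def span_zero)
  have W: "corr (dirderiv v \<phi>) x = 0" if "v \<in> columns \<sigma> \<union> {b + c_mu \<mu>}" "test_function \<phi>" for v \<phi> x
  proof -
    have "t *\<^sub>R v \<in> periods" for t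
      using sum[OF zero_in_G_mu, of "t *\<^sub>R v"] that(1) by (auto simp: W_space_def span_base span_scale)
    then show ?thesis using line_subset_periods_iff that(2) by blast
  qed
  have "column j \<sigma> \<in> columns \<sigma>" for j by (auto simp: columns_def)
  then show ?thesis
    unfolding integral_u_adjoint_op[OF \<psi>] gen_corr_eq_local[OF G \<psi>]
    using W \<psi> test_function_dirderiv[OF \<psi>] by simp
qed

end

section \<open>From Lebesgue classes to bounded Borel representatives\<close>

lemma L_infinity_bounded_borel:
  assumes "u \<in> L_infinity"
  obtains u' C where "bounded_borel u' C" "AE x in lborel. u x = u' x"
proof -
  obtain C where meas: "u \<in> borel_measurable lebesgue" and C: "AE x in lebesgue. \<bar>u x\<bar> \<le> C"
    using assms by (auto simp: L_infinity_def)
  obtain v where v: "v \<in> borel_measurable lborel" "AE x in lborel. u x = v x"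
    using completion_ex_borel_measurable_real[OF meas] by blast
  \<comment> \<open>Clamping makes the bound hold everywhere and changes \<open>v\<close> only on a
    null set.\<close>
  define u' where "u' x = max (- \<bar>C\<bar>) (min \<bar>C\<bar> (v x))" for x
  have "u' \<in> borel_measurable borel"
    unfolding u'_def[abs_def] using v(1) by simp
  then have "bounded_borel u' \<bar>C\<bar>"
    by unfold_locales (auto simp: u'_def)
  moreover have "AE x in lborel. u x = u' x"
    using v(2) C[unfolded AE_completion_iff] by eventually_elim (auto simp: u'_def)
  ultimately show thesis by (rule that)
qed

lemma AE_lborel_shift:
  fixes a :: "'a::euclidean_space"
  assumes "AE x in lborel. P x"
  shows "AE x in lborel. P (x + a)"
proof -
  obtain N where N: "{x. \<not> P x} \<subseteq> N" "N \<in> null_sets lborel"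
    using assms by (auto elim!: AE_E simp: null_sets_def)
  have "emeasure lborel N = emeasure (distr lborel borel ((+) a)) N"
    by (simp only: lborel_distr_plus)
  also have "\<dots> = emeasure lborel ((+) a -` N)"
    using N(2) by (subst emeasure_distr) auto
  finally have "(+) a -` N \<in> null_sets lborel"
    using N(2) measurable_sets[of "(+) a" borel borel N] by (auto simp: null_sets_def)
  then show ?thesis by (rule AE_I') (use N(1) in \<open>auto simp: add.commute\<close>)
qed

text \<open>Completeness of Lebesgue measure makes \<open>f\<close> measurable, as it agrees almost
  everywhere with a Borel function.\<close>

lemma integral_lebesgue_eq_lborel:
  fixes f g :: "'a::euclidean_space \<Rightarrow> real"
  assumes "AE x in lborel. f x = g x" "g \<in> borel_measurable borel"
  shows "(LINT x|lebesgue. f x) = (LINT x|lborel. g x)"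
proof -
  have ae: "AE x in lebesgue. g x = f x"
    using assms(1) by (intro AE_completion) (auto simp: eq_commute)
  have g: "g \<in> borel_measurable lebesgue"
    using assms(2) by (intro measurable_completion) simp
  have "f \<in> borel_measurable lebesgue"
  proof (rule measurableI)
    fix S :: "real set" assume "S \<in> sets borel"
    then have "g -` S \<inter> space lebesgue \<in> sets lebesgue" using g by (rule measurable_sets[rotated])
    moreover have "AE x in lebesgue. x \<in> g -` S \<inter> space lebesgue \<longleftrightarrow> x \<in> f -` S \<inter> space lebesgue"
      using ae by eventually_elim auto
    ultimately show "f -` S \<inter> space lebesgue \<in> sets lebesgue"
      using completion.in_sets_AE by blast
  qed simp
  then have "(LINT x|lebesgue. f x) = (LINT x|lebesgue. g x)"
    using g ae by (intro integral_cong_AE) (auto simp: eq_commute)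
  also have "\<dots> = (LINT x|lborel. g x)"
    using assms(2) by (intro integral_completion) simp
  finally show ?thesis .
qed

lemma levy_measure_integrable_min:
  assumes "levy_measure \<mu>"
  shows "integrable \<mu> (\<lambda>z. min ((norm z)\<^sup>2) 1)"
proof (rule integrableI_bounded)
  have sets: "sets \<mu> = sets (restrict_space borel (- {0}))"
    using assms by (simp add: levy_measure_def radon_measure_punctured_def)
  have "(\<lambda>z::real^'a. min ((norm z)\<^sup>2) 1) \<in> borel_measurable (restrict_space borel (- {0}))"
    by (intro measurable_restrict_space1) measurable
  then show "(\<lambda>z. min ((norm z)\<^sup>2) 1) \<in> borel_measurable \<mu>"
    using measurable_cong_sets[OF sets refl] by blast
qed (use assms in \<open>simp add: levy_measure_def\<close>)

theorem theorem1p2: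
  fixes \<sigma> :: "real^'p^'d" and b :: "real^'d"
    and \<mu> :: "(real^'d) measure" and u :: "real^'d \<Rightarrow> real"
  assumes "levy_measure \<mu>"
    and "u \<in> L_infinity"
  shows "(\<forall>\<psi>. test_function \<psi> \<longrightarrow> levy_distribution \<sigma> b \<mu> u \<psi> = 0)
     \<longleftrightarrow> ae_periodic (closure {g + w | g w. g \<in> G_mu \<mu> \<and> w \<in> W_space \<sigma> (b + c_mu \<mu>)}) u"
proof -
  obtain u' C where u': "bounded_borel u' C" and ae: "AE x in lborel. u x = u' x"
    using L_infinity_bounded_borel[OF assms(2)] .
  interpret bounded_borel u' C by (rule u')
  interpret liouville \<mu> \<sigma> b u' C
    using assms(1) levy_measure_integrable_min[OF assms(1)]
    by unfold_locales (auto simp: levy_measure_def radon_measure_punctured_def)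
  have dist: "levy_distribution \<sigma> b \<mu> u \<psi> = (LINT y|lborel. u' y * adjoint_op \<sigma> b \<mu> \<psi> y)"
    if "test_function \<psi>" for \<psi>
    unfolding levy_distribution_def
    using ae adjoint_op_measurable[OF that]
    by (intro integral_lebesgue_eq_lborel borel_measurable_times u_measurable) auto
  have per: "(LINT x|lebesgue. (u (x + s) - u x) * \<psi> x) = corr \<psi> s - corr \<psi> 0"
    if \<psi>: "test_function \<psi>" for s \<psi>
  proof -
    note [measurable] = test_function_measurable[OF \<psi>]
    have int: "integrable lborel (\<lambda>x. u' (x + s) * \<psi> x)"
    proof -
      interpret shifted: bounded_borel "\<lambda>x. u' (x + s)" C
        by unfold_locales (auto simp: u_bounded)
      show ?thesis by (rule shifted.integrable_u_times[OF test_function_integrable[OF \<psi>]])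
    qed
    have "(LINT x|lebesgue. (u (x + s) - u x) * \<psi> x) = (LINT x|lborel. (u' (x + s) - u' x) * \<psi> x)"
    proof (rule integral_lebesgue_eq_lborel)
      show "AE x in lborel. (u (x + s) - u x) * \<psi> x = (u' (x + s) - u' x) * \<psi> x"
        using ae AE_lborel_shift[OF ae, of s] by eventually_elim simp
    qed measurable
    also have "\<dots> = (LINT x|lborel. u' (x + s) * \<psi> x) - (LINT x|lborel. u' x * \<psi> x)"
      unfolding left_diff_distrib
      by (intro Bochner_Integration.integral_diff int integrable_u_times test_function_integrable \<psi>)
    \<comment> \<open>Substituting y = x + s moves the translation from \<open>u'\<close> to
      \<open>\<psi>\<close>.\<close>
    also have "(LINT x|lborel. u' (x + s) * \<psi> x) = corr \<psi> s"
      using lborel_integral_shift[of "\<lambda>x. u' (x + s) * \<psi> x" s] by (simp add: corr_def)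
    finally show ?thesis by (simp add: corr_def)
  qed
  have "ae_periodic S u \<longleftrightarrow> S \<subseteq> periods" for S
    unfolding ae_periodic_def periods_def subset_iff mem_Collect_eq Ball_def
    by (simp only: per right_minus_eq cong: imp_cong)
  then have "ae_periodic period_group u \<longleftrightarrow> period_group \<subseteq> periods" .
  also have "\<dots> \<longleftrightarrow> (\<forall>\<psi>. test_function \<psi> \<longrightarrow> (LINT y|lborel. u' y * adjoint_op \<sigma> b \<mu> \<psi> y) = 0)"
  proof
    assume "period_group \<subseteq> periods"
    then show "\<forall>\<psi>. test_function \<psi> \<longrightarrow> (LINT y|lborel. u' y * adjoint_op \<sigma> b \<mu> \<psi> y) = 0"
      by (intro allI impI periodic_imp_solution)
  next
    assume "\<forall>\<psi>. test_function \<psi> \<longrightarrow> (LINT y|lborel. u' y * adjoint_op \<sigma> b \<mu> \<psi> y) = 0"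
    then show "period_group \<subseteq> periods"
      by (intro solution_imp_periodic) blast
  qed
  also have "\<dots> \<longleftrightarrow> (\<forall>\<psi>. test_function \<psi> \<longrightarrow> levy_distribution \<sigma> b \<mu> u \<psi> = 0)"
    by (simp only: dist cong: imp_cong)
  finally show ?thesis by (rule sym)
qed

end
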